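(* Let $m,n\ge 1$, let $A=(a_{ij})\in\mathbb{R}^{m\times m}$, $B\in\mathbb{R}^{m\times n}$, $C\in\mathbb{R}^{n\times m}$, $D=(d_{ij})\in\mathbb{R}^{n\times n}$, let $$K=\begin{bmatrix} D & -C\\ -B & A\end{bmatrix}$$ be a regular singular $M$-matrix, and assume that $\alpha>\max_i a_{ii}$ and $\beta>\max_i d_{ii}$. Let $\Phi$ and $\Psi$ be the minimal nonnegative solutions of $XCX-XD-AX+B=0$ and $YBY-YA-DY+C=0$, respectively. Then the ADDA with parameters $\alpha,\beta$, which generates the sequences $\{E_k\},\{F_k\},\{G_k\},\{H_k\}$, is well defined, with $I-G_kH_k$ and $I-H_kG_k$ being nonsingular $M$-matrices for each $k\ge 0$. Moreover, $E_0\le 0$, $F_0\le 0$, and for all $k\ge 1$: $E_k\ge 0$, $F_k\ge 0$, $0\le H_{k-1}\le H_k\le\Phi$, $0\le G_{k-1}\le G_k\le\Psi$; and $$\limsup_{k\to\infty}\sqrt[2^k]{\|H_k-\Phi\|}\le r(\alpha,\beta),\qquad \limsup_{k\to\infty}\sqrt[2^k]{\|G_k-\Psi\|}\le r(\alpha,\beta),$$ where $$r(\alpha,\beta)=\rho\left((R+\alpha I)^{-1}(R-\beta I)\right)\cdot\rho\left((S+\beta I)^{-1}(S-\alpha I)\right)$$ with $R=D-C\Phi$ and $S=A-B\Psi$.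
   Context: For real matrices or vectors of the same size, $A\ge B$ ($A>B$) means $a_{ij}\ge b_{ij}$ ($a_{ij}>b_{ij}$) for all $i,j$; a matrix $X$ is nonnegative if $X\ge 0$. $\rho(\cdot)$ is the spectral radius and $\|\cdot\|$ is any matrix norm. A real square matrix is a $Z$-matrix if all its off-diagonal entries are nonpositive; any $Z$-matrix can be written as $sI-N$ with $N\ge 0$. A $Z$-matrix $sI-N$ ($N\ge 0$) is an $M$-matrix if $s\ge\rho(N)$; it is a singular $M$-matrix if $s=\rho(N)$ and a nonsingular $M$-matrix if $s>\rho(N)$. An $M$-matrix $A$ is regular if $Av\ge 0$ for some vector $v>0$. A minimal nonnegative solution of a matrix equation is a nonnegative solution that is entrywise $\le$ every nonnegative solution. The unknowns are $X\in\mathbb{R}^{m\times n}$ and $Y\in\mathbb{R}^{n\times m}$; when $K$ is a regular $M$-matrix, both $\Phi$ and $\Psi$ exist. The ADDA (a doubling algorithm) with parameters $\alpha,\beta$ generates $E_k\in\mathbb{R}^{n\times n}$, $F_k\in\mathbb{R}^{m\times m}$, $G_k\in\mathbb{R}^{n\times m}$, $H_k\in\mathbb{R}^{m\times n}$ as follows. The initial matrices are determined by $$\begin{bmatrix}E_0 & -G_0\\ -H_0 & F_0\end{bmatrix}=\begin{bmatrix}D+\alpha I_n & -C\\ -B & A+\beta I_m\end{bmatrix}^{-1}\begin{bmatrix}D-\beta I_n & -C\\ -B & A-\alpha I_m\end{bmatrix},$$ and for $k\ge 0$ $$E_{k+1}=E_k(I_n-G_kH_k)^{-1}E_k,\qquad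 F_{k+1}=F_k(I_m-H_kG_k)^{-1}F_k,$$ $$G_{k+1}=G_k+E_k(I_n-G_kH_k)^{-1}G_kF_k,\qquad H_{k+1}=H_k+F_k(I_m-H_kG_k)^{-1}H_kE_k.$$ The algorithm is well defined if all the matrices to be inverted are nonsingular. *)

theory Defs
  imports
    "Jordan_Normal_Form.Spectral_Radius"
    "Jordan_Normal_Form.Gauss_Jordan_Elimination"
    "HOL-Library.Extended_Real"
begin

text \<open>Throughout, \<open>\<le>\<close> on real matrices and vectors is the entrywise order of
  the matrix library, which also requires the dimensions to agree.  The library's
  \<open><\<close> is only the strict part of that order, so entrywise strict
  inequalities are written out with indices.\<close>

definition rho :: "real mat \<Rightarrow> real" where
  "rho A = spectral_radius (map_mat complex_of_real A)"

text \<open>The value is unspecified when \<open>A\<close> is not invertible.\<close>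

definition mat_inv :: "real mat \<Rightarrow> real mat" where
  "mat_inv A = the (mat_inverse A)"

definition Z_matrix :: "real mat \<Rightarrow> bool" where
  "Z_matrix A \<longleftrightarrow> square_mat A \<and>
     (\<forall>i < dim_row A. \<forall>j < dim_col A. i \<noteq> j \<longrightarrow> A $$ (i,j) \<le> 0)"

definition Z_splitting :: "real mat \<Rightarrow> real \<Rightarrow> real mat \<Rightarrow> bool" where
  "Z_splitting A s N \<longleftrightarrow>
     (let k = dim_row A in
        N \<in> carrier_mat k k \<and> 0\<^sub>m k k \<le> N \<and> A = s \<cdot>\<^sub>m 1\<^sub>m k - N)"

lemma Z_matrix_iff_splitting: "Z_matrix A \<longleftrightarrow> (\<exists>s N. Z_splitting A s N)"
proof
  assume Z: "Z_matrix A"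
  define k where "k = dim_row A"
  define s where "s = (\<Sum>i<k. \<bar>A $$ (i,i)\<bar>)"
  define N where "N = s \<cdot>\<^sub>m 1\<^sub>m k - A"
  have sq: "dim_col A = k" using Z by (simp add: Z_matrix_def k_def)
  have diag: "A $$ (i,i) \<le> s" if "i < k" for i
  proof -
    have "\<bar>A $$ (i,i)\<bar> \<le> s"
      unfolding s_def by (rule member_le_sum) (use that in auto)
    then show ?thesis by linarith
  qed
  have "Z_splitting A s N"
    using Z sq diag
    by (auto simp: Z_splitting_def Let_def Z_matrix_def N_def less_eq_mat_def k_def[symmetric]
             intro!: eq_matI)
  then show "\<exists>s N. Z_splitting A s N" by blast
next
  assume "\<exists>s N. Z_splitting A s N"
  then obtain s N where N: "N \<in> carrier_mat (dim_row A) (dim_row A)"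
    and pos: "0\<^sub>m (dim_row A) (dim_row A) \<le> N" and A: "A = s \<cdot>\<^sub>m 1\<^sub>m (dim_row A) - N"
    by (auto simp: Z_splitting_def Let_def)
  have sq: "dim_col A = dim_row A" using A N by (metis carrier_matD(2) index_minus_mat(3))
  have "A $$ (i,j) \<le> 0" if "i < dim_row A" "j < dim_row A" "i \<noteq> j" for i j
  proof -
    have "A $$ (i,j) = (s \<cdot>\<^sub>m 1\<^sub>m (dim_row A) - N) $$ (i,j)" using A by simp
    also have "\<dots> = - (N $$ (i,j))" using that N by simp
    finally show ?thesis using pos that N by (auto simp: less_eq_mat_def)
  qed
  with sq show "Z_matrix A" by (simp add: Z_matrix_def)
qed

definition M_matrix :: "real mat \<Rightarrow> bool" where
  "M_matrix A \<longleftrightarrow> (\<exists>s N. Z_splitting A s N \<and> s \<ge> rho N)"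

definition singular_M_matrix :: "real mat \<Rightarrow> bool" where
  "singular_M_matrix A \<longleftrightarrow> (\<exists>s N. Z_splitting A s N \<and> s = rho N)"

definition nonsingular_M_matrix :: "real mat \<Rightarrow> bool" where
  "nonsingular_M_matrix A \<longleftrightarrow> (\<exists>s N. Z_splitting A s N \<and> s > rho N)"

definition regular_M_matrix :: "real mat \<Rightarrow> bool" where
  "regular_M_matrix A \<longleftrightarrow> M_matrix A \<and>
     (\<exists>v \<in> carrier_vec (dim_col A).
        (\<forall>i < dim_col A. v $ i > 0) \<and> 0\<^sub>v (dim_row A) \<le> A *\<^sub>v v)"

definition min_nonneg_solution :: "nat \<Rightarrow> nat \<Rightarrow> (real mat \<Rightarrow> bool) \<Rightarrow> real mat \<Rightarrow> bool" where
  "min_nonneg_solution p q eqn X \<longleftrightarrow>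
     X \<in> carrier_mat p q \<and> 0\<^sub>m p q \<le> X \<and> eqn X \<and>
     (\<forall>Z \<in> carrier_mat p q. 0\<^sub>m p q \<le> Z \<longrightarrow> eqn Z \<longrightarrow> X \<le> Z)"

text \<open>No submultiplicativity is required, so this covers every matrix norm.\<close>

definition norm_on_mats :: "nat \<Rightarrow> nat \<Rightarrow> (real mat \<Rightarrow> real) \<Rightarrow> bool" where
  "norm_on_mats p q \<nu> \<longleftrightarrow>
     (\<forall>X \<in> carrier_mat p q. \<nu> X \<ge> 0 \<and> (\<nu> X = 0 \<longleftrightarrow> X = 0\<^sub>m p q)) \<and>
     (\<forall>c. \<forall>X \<in> carrier_mat p q. \<nu> (c \<cdot>\<^sub>m X) = \<bar>c\<bar> * \<nu> X) \<and>
     (\<forall>X \<in> carrier_mat p q. \<forall>Y \<in> carrier_mat p q. \<nu> (X + Y) \<le> \<nu> X + \<nu> Y)"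

text \<open>Here \<open>n = dim_row D\<close> and \<open>m = dim_row A\<close>.  \<open>adda_lhs\<close> is the
  matrix that is inverted to obtain the initial matrices.\<close>

definition adda_lhs :: "real mat \<Rightarrow> real mat \<Rightarrow> real mat \<Rightarrow> real mat \<Rightarrow> real \<Rightarrow> real \<Rightarrow> real mat" where
  "adda_lhs A B C D \<alpha> \<beta> =
     four_block_mat (D + \<alpha> \<cdot>\<^sub>m 1\<^sub>m (dim_row D)) (- C)
                    (- B) (A + \<beta> \<cdot>\<^sub>m 1\<^sub>m (dim_row A))"

definition adda_rhs :: "real mat \<Rightarrow> real mat \<Rightarrow> real mat \<Rightarrow> real mat \<Rightarrow> real \<Rightarrow> real \<Rightarrow> real mat" where
  "adda_rhs A B C D \<alpha> \<beta> =
     four_block_mat (D - \<beta> \<cdot>\<^sub>m 1\<^sub>m (dim_row D)) (- C)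
                    (- B) (A - \<alpha> \<cdot>\<^sub>m 1\<^sub>m (dim_row A))"

type_synonym adda_state = "real mat \<times> real mat \<times> real mat \<times> real mat"

definition adda_init ::
    "real mat \<Rightarrow> real mat \<Rightarrow> real mat \<Rightarrow> real mat \<Rightarrow> real \<Rightarrow> real \<Rightarrow> adda_state" where
  "adda_init A B C D \<alpha> \<beta> =
     (case split_block (mat_inv (adda_lhs A B C D \<alpha> \<beta>) * adda_rhs A B C D \<alpha> \<beta>)
             (dim_row D) (dim_row D)
      of (P11, P12, P21, P22) \<Rightarrow> (P11, P22, - P12, - P21))"

fun adda_step :: "adda_state \<Rightarrow> adda_state" where
  "adda_step (E, F, G, H) =
     (let U = mat_inv (1\<^sub>m (dim_row G) - G * H);
          V = mat_inv (1\<^sub>m (dim_row H) - H * G)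
      in (E * U * E, F * V * F, G + E * U * G * F, H + F * V * H * E))"

primrec adda ::
    "real mat \<Rightarrow> real mat \<Rightarrow> real mat \<Rightarrow> real mat \<Rightarrow> real \<Rightarrow> real \<Rightarrow> nat \<Rightarrow> adda_state" where
  "adda A B C D \<alpha> \<beta> 0 = adda_init A B C D \<alpha> \<beta>"
| "adda A B C D \<alpha> \<beta> (Suc k) = adda_step (adda A B C D \<alpha> \<beta> k)"

definition adda_well_defined ::
    "real mat \<Rightarrow> real mat \<Rightarrow> real mat \<Rightarrow> real mat \<Rightarrow> real \<Rightarrow> real \<Rightarrow> bool" where
  "adda_well_defined A B C D \<alpha> \<beta> \<longleftrightarrow>
     invertible_mat (adda_lhs A B C D \<alpha> \<beta>) \<and>
     (\<forall>k. case adda A B C D \<alpha> \<beta> k of (E, F, G, H) \<Rightarrow>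
        invertible_mat (1\<^sub>m (dim_row G) - G * H) \<and>
        invertible_mat (1\<^sub>m (dim_row H) - H * G))"

text \<open>\<open>R\<close> is \<open>n \<times> n\<close> and \<open>S\<close> is \<open>m \<times> m\<close>.\<close>

definition adda_rate :: "nat \<Rightarrow> nat \<Rightarrow> real mat \<Rightarrow> real mat \<Rightarrow> real \<Rightarrow> real \<Rightarrow> real" where
  "adda_rate m n R S \<alpha> \<beta> =
     rho (mat_inv (R + \<alpha> \<cdot>\<^sub>m 1\<^sub>m n) * (R - \<beta> \<cdot>\<^sub>m 1\<^sub>m n)) *
     rho (mat_inv (S + \<beta> \<cdot>\<^sub>m 1\<^sub>m m) * (S - \<alpha> \<cdot>\<^sub>m 1\<^sub>m m))"

end

theory Submission
  imports Defs
begin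

text \<open>Regularity of \<open>K\<close> gives a positive vector, with blocks \<open>v1\<close> and \<open>v2\<close>, such that
  \<open>C *\<^sub>v v2 \<le> D *\<^sub>v v1\<close> and \<open>B *\<^sub>v v1 \<le> A *\<^sub>v v2\<close>.  A monotone fixed-point iteration from zero that
  preserves \<open>X *\<^sub>v v1 \<le> v2\<close> converges to a nonnegative solution, so minimality yields
  \<open>\<Phi> *\<^sub>v v1 \<le> v2\<close>, and symmetrically \<open>\<Psi> *\<^sub>v v2 \<le> v1\<close> (\<open>min_solution_le_positive_vec\<close>).

  Put \<open>T = mat_inv (R + \<alpha>I) * (R - \<beta>I)\<close> and \<open>U = mat_inv (S + \<beta>I) * (S - \<alpha>I)\<close>.  The matrix
  that is inverted for the initial matrices, and also \<open>R + \<alpha>I\<close> and \<open>S + \<beta>I\<close>, are Z-matrices that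
  map a positive vector to a positive vector; hence their inverses are nonnegative with positive
  diagonal (\<open>mat_inv_Z_mat\<close>).  As \<open>\<alpha>\<close> and \<open>\<beta>\<close> strictly exceed the diagonal entries, the matrices
  \<open>- E 0\<close>, \<open>- F 0\<close>, \<open>- T\<close> and \<open>- U\<close> are nonnegative with positive diagonal, while \<open>G 0\<close> and
  \<open>H 0\<close> are nonnegative.

  The Riccati equations give the identities
  \<open>E k = (I - G k * \<Phi>) * T\<^sub>k\<close>, \<open>\<Phi> - H k = F k * \<Phi> * T\<^sub>k\<close>,
  \<open>F k = (I - H k * \<Psi>) * U\<^sub>k\<close>, \<open>\<Psi> - G k = E k * \<Psi> * U\<^sub>k\<close> with \<open>T\<^sub>k = T ^\<^sub>m (2 ^ k)\<close> and
  \<open>U\<^sub>k = U ^\<^sub>m (2 ^ k)\<close>, which the doubling step preserves.  Since the diagonals of \<open>F k\<close> and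
  \<open>T\<^sub>k\<close> are positive up to a common sign, \<open>\<Phi> - H k \<ge> c \<cdot>\<^sub>m \<Phi>\<close> for some \<open>c > 0\<close>.  Therefore
  \<open>(G k * H k) *\<^sub>v v1 \<le> (1 - c) \<cdot>\<^sub>v v1\<close>, so \<open>G k * H k\<close> has spectral radius below \<open>1\<close>
  (\<open>doubling_state_inverse\<close>), even where equality holds in \<open>\<Phi> *\<^sub>v v1 \<le> v2\<close> and
  \<open>\<Psi> *\<^sub>v v2 \<le> v1\<close>.

  For \<open>k \<ge> 1\<close> the matrix \<open>F k = U\<^sub>k - H k * \<Psi> * U\<^sub>k\<close> lies below \<open>U\<^sub>k\<close>, whence
  \<open>0 \<le> \<Phi> - H k \<le> U\<^sub>k * \<Phi> * T\<^sub>k\<close>, and the rate follows from the growth bound for matrix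
  powers in terms of the spectral radius (\<open>limsup_root_norm_le_rho_mult_rho\<close>).  All statements
  about \<open>F\<close>, \<open>G\<close>, \<open>\<Psi>\<close>, \<open>U\<close> are those about \<open>E\<close>, \<open>H\<close>, \<open>\<Phi>\<close>, \<open>T\<close> after exchanging
  \<open>A\<close> with \<open>D\<close>, \<open>B\<close> with \<open>C\<close> and \<open>\<alpha>\<close> with \<open>\<beta>\<close>.\<close>

section \<open>Entries and the entrywise order\<close>

lemma mat_entry_cong: "A = B \<Longrightarrow> A $$ (i,j) = B $$ (i,j)"
  by simp

lemma mult_mat_entry:
  fixes A B :: "'a :: comm_semiring_0 mat"
  assumes "A \<in> carrier_mat p q" "B \<in> carrier_mat q r" "i < p" "j < r"
  shows "(A * B) $$ (i,j) = (\<Sum>l<q. A $$ (i,l) * B $$ (l,j))"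
  using assms by (auto simp: scalar_prod_def atLeast0LessThan)

lemma mult_mat_vec_entry:
  fixes A :: "'a :: comm_semiring_0 mat"
  assumes "A \<in> carrier_mat p q" "v \<in> carrier_vec q" "i < p"
  shows "(A *\<^sub>v v) $ i = (\<Sum>l<q. A $$ (i,l) * v $ l)"
  using assms by (auto simp: scalar_prod_def atLeast0LessThan)

lemma scalar_mat_mult_vec:
  fixes v :: "real vec"
  assumes v: "v \<in> carrier_vec k"
  shows "(c \<cdot>\<^sub>m 1\<^sub>m k) *\<^sub>v v = c \<cdot>\<^sub>v v"
proof (rule eq_vecI)
  fix i assume "i < dim_vec (c \<cdot>\<^sub>v v)"
  then have i: "i < k" using v by simp
  have "((c \<cdot>\<^sub>m 1\<^sub>m k) *\<^sub>v v) $ i = (\<Sum>l<k. (c \<cdot>\<^sub>m 1\<^sub>m k) $$ (i,l) * v $ l)"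
    by (rule mult_mat_vec_entry[OF _ v i]) simp
  also have "\<dots> = (\<Sum>l<k. if l = i then c * v $ l else 0)"
    by (rule sum.cong) (use i in auto)
  also have "\<dots> = (c \<cdot>\<^sub>v v) $ i" using i v by simp
  finally show "((c \<cdot>\<^sub>m 1\<^sub>m k) *\<^sub>v v) $ i = (c \<cdot>\<^sub>v v) $ i" .
qed (use v in auto)

lemma mat_leI:
  assumes "A \<in> carrier_mat p q" "B \<in> carrier_mat p q"
    and "\<And>i j. i < p \<Longrightarrow> j < q \<Longrightarrow> A $$ (i,j) \<le> B $$ (i,j)"
  shows "A \<le> B"
  using assms by (auto simp: less_eq_mat_def)

lemma mat_leD:
  assumes "A \<le> B" "A \<in> carrier_mat p q" "i < p" "j < q"
  shows "A $$ (i,j) \<le> B $$ (i,j)"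
  using assms by (auto simp: less_eq_mat_def)

lemma nonneg_matD:
  assumes "0\<^sub>m p q \<le> A" "i < p" "j < q"
  shows "0 \<le> A $$ (i,j)"
  using mat_leD[OF assms(1) zero_carrier_mat assms(2,3)] assms by simp

lemma mat_le_carrier: "A \<le> B \<Longrightarrow> A \<in> carrier_mat p q \<Longrightarrow> B \<in> carrier_mat p q"
  by (auto simp: less_eq_mat_def)

lemma vec_leI:
  assumes "v \<in> carrier_vec q" "w \<in> carrier_vec q" "\<And>i. i < q \<Longrightarrow> v $ i \<le> w $ i"
  shows "v \<le> w"
  using assms by (auto simp: less_eq_vec_def)

lemma vec_leD:
  assumes "v \<le> w" "v \<in> carrier_vec q" "i < q"
  shows "v $ i \<le> w $ i"
  using assms by (auto simp: less_eq_vec_def)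

lemma nonneg_vecD:
  assumes "0\<^sub>v q \<le> v" "i < q"
  shows "0 \<le> v $ i"
  using vec_leD[OF assms(1) zero_carrier_vec assms(2)] assms by simp

lemma mult_mat_mono:
  fixes A A' B B' :: "real mat"
  assumes A: "A \<in> carrier_mat p q" "0\<^sub>m p q \<le> A" "A \<le> A'"
    and B: "B \<in> carrier_mat q r" "0\<^sub>m q r \<le> B" "B \<le> B'"
  shows "A * B \<le> A' * B'"
  using assms unfolding less_eq_mat_def
  by (auto simp: scalar_prod_def intro!: sum_mono mult_mono)
     (meson atLeastLessThan_iff le0 order_trans)+

lemma mult_mat_nonneg:
  fixes A B :: "real mat"
  assumes "A \<in> carrier_mat p q" "0\<^sub>m p q \<le> A" "B \<in> carrier_mat q r" "0\<^sub>m q r \<le> B"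
  shows "0\<^sub>m p r \<le> A * B"
  using assms unfolding less_eq_mat_def
  by (auto simp: scalar_prod_def intro!: sum_nonneg)

lemma mult_mat_vec_mono:
  fixes A A' :: "real mat"
  assumes A: "A \<in> carrier_mat p q" "0\<^sub>m p q \<le> A" "A \<le> A'"
    and v: "v \<in> carrier_vec q" "0\<^sub>v q \<le> v" "v \<le> w"
  shows "A *\<^sub>v v \<le> A' *\<^sub>v w"
  using assms unfolding less_eq_mat_def less_eq_vec_def
  by (auto simp: scalar_prod_def intro!: sum_mono mult_mono)
     (meson atLeastLessThan_iff le0 order_trans)+

lemma mult_mat_nonneg_vec:
  fixes A :: "real mat"
  assumes A: "A \<in> carrier_mat p q" "0\<^sub>m p q \<le> A" and v: "v \<in> carrier_vec q" "0\<^sub>v q \<le> v"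
  shows "0\<^sub>v p \<le> A *\<^sub>v v"
proof (rule vec_leI)
  fix i assume i: "i < p"
  have "0 \<le> (\<Sum>l<q. A $$ (i,l) * v $ l)"
    using nonneg_matD[OF A(2) i] nonneg_vecD[OF v(2)] by (intro sum_nonneg mult_nonneg_nonneg) auto
  then show "0\<^sub>v p $ i \<le> (A *\<^sub>v v) $ i" using i mult_mat_vec_entry[OF A(1) v(1) i] by simp
qed (use A v in auto)

lemma add_mat_nonneg:
  fixes A B :: "real mat"
  shows "0\<^sub>m p q \<le> A \<Longrightarrow> 0\<^sub>m p q \<le> B \<Longrightarrow> 0\<^sub>m p q \<le> A + B"
  by (auto simp: less_eq_mat_def)

lemma add_mat_mono:
  fixes A A' B B' :: "real mat"
  assumes "A \<in> carrier_mat p q" "B \<in> carrier_mat p q"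
  shows "A \<le> A' \<Longrightarrow> B \<le> B' \<Longrightarrow> A + B \<le> A' + B'"
  using assms by (auto simp: less_eq_mat_def add_mono)

lemma mat_le_add_nonneg:
  fixes A B :: "real mat"
  assumes "A \<in> carrier_mat p q" "B \<in> carrier_mat p q" "0\<^sub>m p q \<le> B"
  shows "A \<le> A + B"
  by (rule mat_leI[of _ p q]) (use assms nonneg_matD[OF assms(3)] in auto)

section \<open>Matrix algebra\<close>

text \<open>The ring laws with premises on dimensions instead of carriers: the simplifier can discharge such
  premises for compound terms, and thus bring products of rectangular matrices into a normal form
  whose entries are compared by linear arithmetic.\<close>

lemma assoc_mult_mat_dim:
  fixes A :: "'a :: comm_ring_1 mat"
  shows "dim_col A = dim_row B \<Longrightarrow> dim_col B = dim_row C \<Longrightarrow>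
    A * B * C = A * (B * C)"
  by (rule assoc_mult_mat[OF carrier_matI[OF refl refl] carrier_matI[OF _ refl] carrier_matI[OF _ refl]]; simp)

lemma mult_add_distrib_mat_dim:
  fixes A :: "'a :: comm_ring_1 mat"
  shows "dim_col A = dim_row B \<Longrightarrow> dim_row B = dim_row C \<Longrightarrow> dim_col B = dim_col C \<Longrightarrow>
    A * (B + C) = A * B + A * C"
  by (rule mult_add_distrib_mat[OF carrier_matI[OF refl refl] carrier_matI[OF _ refl] carrier_matI]; simp)

lemma mult_minus_distrib_mat_dim:
  fixes A :: "'a :: comm_ring_1 mat"
  shows "dim_col A = dim_row B \<Longrightarrow> dim_row B = dim_row C \<Longrightarrow> dim_col B = dim_col C \<Longrightarrow>
    A * (B - C) = A * B - A * C"
  by (rule mult_minus_distrib_mat[OF carrier_matI[OF refl refl] carrier_matI[OF _ refl] carrier_matI]; simp)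

lemma add_mult_distrib_mat_dim:
  fixes A :: "'a :: comm_ring_1 mat"
  shows "dim_row A = dim_row B \<Longrightarrow> dim_col A = dim_col B \<Longrightarrow> dim_col B = dim_row C \<Longrightarrow>
    (A + B) * C = A * C + B * C"
  by (rule add_mult_distrib_mat[OF carrier_matI[OF refl refl] carrier_matI carrier_matI[OF _ refl]]; simp)

lemma minus_mult_distrib_mat_dim:
  fixes A :: "'a :: comm_ring_1 mat"
  shows "dim_row A = dim_row B \<Longrightarrow> dim_col A = dim_col B \<Longrightarrow> dim_col B = dim_row C \<Longrightarrow>
    (A - B) * C = A * C - B * C"
  by (rule minus_mult_distrib_mat[OF carrier_matI[OF refl refl] carrier_matI carrier_matI[OF _ refl]]; simp)

lemma mult_smult_assoc_mat_dim:
  fixes A :: "'a :: comm_ring_1 mat"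
  shows "dim_col A = dim_row B \<Longrightarrow> (k \<cdot>\<^sub>m A) * B = k \<cdot>\<^sub>m (A * B)"
  by (rule mult_smult_assoc_mat[OF carrier_matI[OF refl refl] carrier_matI[OF _ refl]]; simp)

lemma mult_smult_distrib_dim:
  fixes A :: "'a :: comm_ring_1 mat"
  shows "dim_col A = dim_row B \<Longrightarrow> A * (k \<cdot>\<^sub>m B) = k \<cdot>\<^sub>m (A * B)"
  by (rule mult_smult_distrib[OF carrier_matI[OF refl refl] carrier_matI[OF _ refl]]; simp)

lemma right_mult_one_mat_dim:
  fixes A :: "'a :: comm_ring_1 mat"
  shows "dim_col A = d \<Longrightarrow> A * 1\<^sub>m d = A"
  by (rule right_mult_one_mat[OF carrier_matI[OF refl]]; simp)

lemma left_mult_one_mat_dim: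
  fixes A :: "'a :: comm_ring_1 mat"
  shows "dim_row A = d \<Longrightarrow> 1\<^sub>m d * A = A"
  by (rule left_mult_one_mat[OF carrier_matI[OF _ refl]]; simp)

lemmas mat_dim_algebra =
  assoc_mult_mat_dim
  mult_add_distrib_mat_dim
  mult_minus_distrib_mat_dim
  add_mult_distrib_mat_dim
  minus_mult_distrib_mat_dim
  mult_smult_assoc_mat_dim
  mult_smult_distrib_dim
  right_mult_one_mat_dim
  left_mult_one_mat_dim

lemma uminus_mult_uminus_mat:
  fixes A B :: "'a :: ring mat"
  assumes "dim_col A = dim_row B"
  shows "- A * - B = A * B" "A * - B = - (A * B)" "- A * B = - (A * B)"
  using assms by auto

lemma pow_mat_double:
  fixes A :: "'a :: semiring_1 mat"
  assumes A: "A \<in> carrier_mat k k"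
  shows "A ^\<^sub>m l * A ^\<^sub>m l = A ^\<^sub>m (2 * l)"
proof -
  have "A ^\<^sub>m (l + p) = A ^\<^sub>m l * A ^\<^sub>m p" for p
    by (induction p) (use A in \<open>simp_all add: assoc_mult_mat[of _ k k _ k _ k]\<close>)
  from this[of l] show ?thesis by (simp add: mult_2)
qed

lemma four_block_mat_inject:
  assumes "four_block_mat A B C D = four_block_mat A' B' C' D'"
    and c: "A \<in> carrier_mat p q" "B \<in> carrier_mat p s" "C \<in> carrier_mat r q" "D \<in> carrier_mat r s"
      "A' \<in> carrier_mat p q" "B' \<in> carrier_mat p s" "C' \<in> carrier_mat r q" "D' \<in> carrier_mat r s"
  shows "A = A'" "B = B'" "C = C'" "D = D'"
proof -
  have e: "four_block_mat A B C D $$ (i,j) = four_block_mat A' B' C' D' $$ (i,j)" for i j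
    by (simp only: assms(1))
  show "A = A'"
  proof (rule eq_matI)
    fix i j assume "i < dim_row A'" "j < dim_col A'"
    then show "A $$ (i,j) = A' $$ (i,j)" using e[of i j] c by auto
  qed (use c in auto)
  show "B = B'"
  proof (rule eq_matI)
    fix i j assume "i < dim_row B'" "j < dim_col B'"
    then show "B $$ (i,j) = B' $$ (i,j)" using e[of i "j + q"] c by auto
  qed (use c in auto)
  show "C = C'"
  proof (rule eq_matI)
    fix i j assume "i < dim_row C'" "j < dim_col C'"
    then show "C $$ (i,j) = C' $$ (i,j)" using e[of "i + p" j] c by auto
  qed (use c in auto)
  show "D = D'"
  proof (rule eq_matI)
    fix i j assume "i < dim_row D'" "j < dim_col D'"
    then show "D $$ (i,j) = D' $$ (i,j)" using e[of "i + p" "j + q"] c by auto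
  qed (use c in auto)
qed

section \<open>Z-matrices that map a positive vector to a positive vector\<close>

text \<open>A minimum principle: at an index where \<open>x $ i / v $ i\<close> is smallest, a negative value \<open>q\<close> would
  force \<open>(A *\<^sub>v x) $ i \<le> q * (A *\<^sub>v v) $ i < 0\<close>.\<close>

lemma Z_mat_vec_nonneg_imp_nonneg:
  fixes A :: "real mat"
  assumes A: "A \<in> carrier_mat k k"
    and Z: "\<And>i j. i < k \<Longrightarrow> j < k \<Longrightarrow> i \<noteq> j \<Longrightarrow> A $$ (i,j) \<le> 0"
    and v: "v \<in> carrier_vec k" "\<And>i. i < k \<Longrightarrow> 0 < v $ i" "\<And>i. i < k \<Longrightarrow> 0 < (A *\<^sub>v v) $ i"
    and x: "x \<in> carrier_vec k" "\<And>i. i < k \<Longrightarrow> 0 \<le> (A *\<^sub>v x) $ i"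
    and j: "j < k"
  shows "0 \<le> x $ j"
proof (rule ccontr)
  assume neg: "\<not> 0 \<le> x $ j"
  have "\<exists>i\<in>{..<k}. \<forall>l\<in>{..<k}. x $ i / v $ i \<le> x $ l / v $ l"
    using ex_is_arg_min_if_finite[of "{..<k}" "\<lambda>i. x $ i / v $ i"] j
    by (auto simp: is_arg_min_linorder)
  then obtain i where i: "i < k" "\<And>l. l < k \<Longrightarrow> x $ i / v $ i \<le> x $ l / v $ l" by auto
  define q where "q = x $ i / v $ i"
  have "q \<le> x $ j / v $ j" using i(2)[OF j] by (simp add: q_def)
  also have "\<dots> < 0" using neg v(2)[OF j] by (simp add: divide_neg_pos)
  finally have q: "q < 0" .
  have le: "A $$ (i,l) * x $ l \<le> q * (A $$ (i,l) * v $ l)" if l: "l < k" for l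
  proof (cases "l = i")
    case True
    then show ?thesis using v(2)[OF i(1)] by (simp add: q_def field_simps)
  next
    case False
    have "q * v $ l \<le> x $ l"
      using i(2)[OF l] v(2)[OF l] by (simp add: q_def[symmetric] pos_le_divide_eq)
    from mult_left_mono_neg[OF this Z[OF i(1) l]] False show ?thesis
      by (simp add: algebra_simps)
  qed
  have "(A *\<^sub>v x) $ i = (\<Sum>l<k. A $$ (i,l) * x $ l)"
    using A x i(1) by (auto simp: scalar_prod_def atLeast0LessThan)
  also have "\<dots> \<le> (\<Sum>l<k. q * (A $$ (i,l) * v $ l))"
    by (rule sum_mono) (use le in auto)
  also have "\<dots> = q * (A *\<^sub>v v) $ i"
    using A v i(1) by (auto simp: scalar_prod_def atLeast0LessThan sum_distrib_left)
  also have "\<dots> < 0" using q v(3)[OF i(1)] by (simp add: mult_neg_pos)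
  finally show False using x(2)[OF i(1)] by simp
qed

lemma mat_inv_nonsingular:
  fixes A :: "real mat"
  assumes A: "A \<in> carrier_mat k k"
    and inj: "\<And>x. x \<in> carrier_vec k \<Longrightarrow> A *\<^sub>v x = 0\<^sub>v k \<Longrightarrow> x = 0\<^sub>v k"
  shows "mat_inv A \<in> carrier_mat k k" "A * mat_inv A = 1\<^sub>m k" "mat_inv A * A = 1\<^sub>m k"
    "invertible_mat A"
proof -
  have "det A \<noteq> 0" using det_0_iff_vec_prod_zero[OF A] inj by auto
  from det_non_zero_imp_unit[OF A this, of "()"] mat_inverse(1)[OF A, of "()"]
  have "mat_inverse A \<noteq> None" by blast
  then obtain B where B: "mat_inverse A = Some B" by blast
  from mat_inverse(2)[OF A B] B
  show inv: "mat_inv A \<in> carrier_mat k k" "A * mat_inv A = 1\<^sub>m k" "mat_inv A * A = 1\<^sub>m k"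
    by (auto simp: mat_inv_def)
  then show "invertible_mat A"
    using A by (auto simp: invertible_mat_def inverts_mat_def)
qed

text \<open>The diagonal of the inverse is positive because
  \<open>1 = (A * mat_inv A) $$ (i,i) \<le> A $$ (i,i) * mat_inv A $$ (i,i)\<close>: the off-diagonal entries of
  \<open>A\<close> contribute nonpositive terms only.\<close>

lemma mat_inv_Z_mat:
  fixes A :: "real mat"
  assumes A: "A \<in> carrier_mat k k"
    and Z: "\<And>i j. i < k \<Longrightarrow> j < k \<Longrightarrow> i \<noteq> j \<Longrightarrow> A $$ (i,j) \<le> 0"
    and v: "v \<in> carrier_vec k" "\<And>i. i < k \<Longrightarrow> 0 < v $ i" "\<And>i. i < k \<Longrightarrow> 0 < (A *\<^sub>v v) $ i"
  shows "mat_inv A \<in> carrier_mat k k" "A * mat_inv A = 1\<^sub>m k" "mat_inv A * A = 1\<^sub>m k"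
    "invertible_mat A" "0\<^sub>m k k \<le> mat_inv A" "\<And>i. i < k \<Longrightarrow> 0 < mat_inv A $$ (i,i)"
proof -
  have inj: "x = 0\<^sub>v k" if x: "x \<in> carrier_vec k" "A *\<^sub>v x = 0\<^sub>v k" for x
  proof (rule eq_vecI)
    fix j assume "j < dim_vec (0\<^sub>v k :: real vec)"
    then have j: "j < k" by simp
    have "A *\<^sub>v (- x) = - (A *\<^sub>v x)"
      using A x(1) by (intro eq_vecI) (auto simp: scalar_prod_def sum_negf)
    then have x': "A *\<^sub>v (- x) = 0\<^sub>v k" by (auto simp: x(2))
    have "0 \<le> x $ j" "0 \<le> (- x) $ j"
      by (rule Z_mat_vec_nonneg_imp_nonneg[OF A Z v _ _ j]; use x x' in simp)+
    then show "x $ j = 0\<^sub>v k $ j" using x j by simp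
  qed (use x in auto)
  note inv = mat_inv_nonsingular[OF A inj]
  show "mat_inv A \<in> carrier_mat k k" "A * mat_inv A = 1\<^sub>m k" "mat_inv A * A = 1\<^sub>m k"
    "invertible_mat A" by (simp_all add: inv)
  have nonneg: "0 \<le> mat_inv A $$ (i,j)" if "i < k" "j < k" for i j
  proof -
    have "A *\<^sub>v col (mat_inv A) j = col (A * mat_inv A) j"
      using A inv(1) that by auto
    then have c: "A *\<^sub>v col (mat_inv A) j = col (1\<^sub>m k) j" using inv(2) by simp
    have "0 \<le> col (mat_inv A) j $ i"
      by (rule Z_mat_vec_nonneg_imp_nonneg[OF A Z v _ _ that(1)]; (unfold c)?; use inv(1) that in auto)
    then show ?thesis using inv(1) that by simp
  qed
  then show "0\<^sub>m k k \<le> mat_inv A" using inv(1) by (auto simp: less_eq_mat_def)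
  show "0 < mat_inv A $$ (i,i)" if i: "i < k" for i
  proof -
    have "1 = (A * mat_inv A) $$ (i,i)" using inv(2) i by simp
    also have "\<dots> = (\<Sum>l<k. A $$ (i,l) * mat_inv A $$ (l,i))"
      using A inv(1) i by (auto simp: scalar_prod_def atLeast0LessThan)
    also have "\<dots> = A $$ (i,i) * mat_inv A $$ (i,i) +
        (\<Sum>l\<in>{..<k} - {i}. A $$ (i,l) * mat_inv A $$ (l,i))"
      by (rule sum.remove) (use i in auto)
    also have "(\<Sum>l\<in>{..<k} - {i}. A $$ (i,l) * mat_inv A $$ (l,i)) \<le> 0"
      by (rule sum_nonpos) (use i nonneg Z in \<open>auto intro!: mult_nonpos_nonneg\<close>)
    finally have "mat_inv A $$ (i,i) \<noteq> 0" by auto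
    with nonneg[OF i i] show ?thesis by simp
  qed
qed

lemma Z_mat_diag_nonneg:
  fixes A :: "real mat"
  assumes A: "A \<in> carrier_mat k k"
    and Z: "\<And>i j. i < k \<Longrightarrow> j < k \<Longrightarrow> i \<noteq> j \<Longrightarrow> A $$ (i,j) \<le> 0"
    and v: "v \<in> carrier_vec k" "\<And>i. i < k \<Longrightarrow> 0 < v $ i"
    and i: "i < k" "0 \<le> (A *\<^sub>v v) $ i"
  shows "0 \<le> A $$ (i,i)"
proof -
  have "0 \<le> (\<Sum>l<k. A $$ (i,l) * v $ l)" using i(2) mult_mat_vec_entry[OF A v(1) i(1)] by simp
  also have "\<dots> = A $$ (i,i) * v $ i + (\<Sum>l\<in>{..<k} - {i}. A $$ (i,l) * v $ l)"
    by (rule sum.remove) (use i in auto)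
  also have "(\<Sum>l\<in>{..<k} - {i}. A $$ (i,l) * v $ l) \<le> 0"
    by (rule sum_nonpos) (use i Z v(2) in \<open>auto intro!: mult_nonpos_nonneg simp: less_imp_le\<close>)
  finally show ?thesis using v(2)[OF i(1)] by (simp add: zero_le_mult_iff)
qed

section \<open>The spectral radius\<close>

lemma rho_nonneg:
  assumes "A \<in> carrier_mat k k" "0 < k"
  shows "0 \<le> rho A"
  using spectral_radius_mem_max(1)[of "map_mat complex_of_real A" k] assms
  by (auto simp: rho_def)

text \<open>The easy half of the Collatz-Wielandt bound, obtained from the entry of an eigenvector of maximal
  modulus relative to \<open>v\<close>.\<close>

lemma rho_le_if_subinvariant:
  fixes N :: "real mat"
  assumes N: "N \<in> carrier_mat k k" "0\<^sub>m k k \<le> N" and k: "0 < k"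
    and v: "v \<in> carrier_vec k" "\<And>i. i < k \<Longrightarrow> 0 < v $ i"
    and le: "N *\<^sub>v v \<le> q \<cdot>\<^sub>v v"
  shows "rho N \<le> q"
proof -
  define M where "M = map_mat complex_of_real N"
  have M: "M \<in> carrier_mat k k" using N by (simp add: M_def)
  obtain \<mu> where \<mu>: "\<mu> \<in> spectrum M" "rho N = norm \<mu>"
    using spectral_radius_mem_max(1)[OF M k] by (auto simp: rho_def M_def)
  then obtain x where x: "x \<in> carrier_vec k" "x \<noteq> 0\<^sub>v k" "M *\<^sub>v x = \<mu> \<cdot>\<^sub>v x"
    using M by (auto simp: spectrum_def eigenvalue_def eigenvector_def)
  have "\<exists>i\<in>{..<k}. \<forall>l\<in>{..<k}. - (norm (x $ i) / v $ i) \<le> - (norm (x $ l) / v $ l)"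
    using ex_is_arg_min_if_finite[of "{..<k}" "\<lambda>i. - (norm (x $ i) / v $ i)"] k
    by (auto simp: is_arg_min_linorder)
  then obtain i where i: "i < k" "\<And>l. l < k \<Longrightarrow> norm (x $ l) / v $ l \<le> norm (x $ i) / v $ i"
    by auto
  define t where "t = norm (x $ i) / v $ i"
  have t: "norm (x $ l) \<le> t * v $ l" if "l < k" for l
    using i(2)[OF that] v(2)[OF that] by (simp add: t_def[symmetric] pos_divide_le_eq)
  have ti: "norm (x $ i) = t * v $ i" using v(2)[OF i(1)] by (simp add: t_def)
  have "t \<noteq> 0"
  proof
    assume "t = 0"
    then have "x = 0\<^sub>v k" using t x(1) by (intro eq_vecI) auto
    with x(2) show False ..
  qed
  moreover have "0 \<le> t" using v(2)[OF i(1)] by (simp add: t_def)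
  ultimately have tpos: "0 < t * v $ i" using v(2)[OF i(1)] by simp
  have "norm \<mu> * (t * v $ i) = norm ((\<mu> \<cdot>\<^sub>v x) $ i)"
    using x(1) i(1) by (simp add: norm_mult ti)
  also have "(\<mu> \<cdot>\<^sub>v x) $ i = (\<Sum>l<k. of_real (N $$ (i,l)) * x $ l)"
    unfolding x(3)[symmetric] using N x(1) i(1)
    by (auto simp: M_def scalar_prod_def atLeast0LessThan)
  also have "norm \<dots> \<le> (\<Sum>l<k. N $$ (i,l) * (t * v $ l))"
    by (rule sum_norm_le) (use N i(1) t in \<open>auto simp: norm_mult less_eq_mat_def intro!: mult_left_mono\<close>)
  also have "\<dots> = t * (N *\<^sub>v v) $ i"
    using N v(1) i(1) by (auto simp: scalar_prod_def atLeast0LessThan sum_distrib_left mult_ac)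
  also have "\<dots> \<le> t * (q * v $ i)"
    using le \<open>0 \<le> t\<close> i(1) v(1) by (intro mult_left_mono) (auto simp: less_eq_vec_def)
  finally have "norm \<mu> * (t * v $ i) \<le> q * (t * v $ i)" by (simp add: mult_ac)
  then have "norm \<mu> \<le> q" using tpos by (rule mult_right_le_imp_le)
  then show ?thesis using \<mu>(2) by simp
qed

text \<open>The growth bound that plays the part of Gelfand's formula: the matrix scaled by \<open>1 / s\<close> has
  spectral radius below \<open>1\<close>, hence bounded powers.\<close>

lemma pow_mat_entry_bound:
  assumes A: "A \<in> carrier_mat k k" and k: "0 < k" and s: "rho A < s"
  obtains c where "0 < c" "\<And>l i j. i < k \<Longrightarrow> j < k \<Longrightarrow> \<bar>(A ^\<^sub>m l) $$ (i,j)\<bar> \<le> c * s ^ l"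
proof -
  have s0: "0 < s" using rho_nonneg[OF A k] s by simp
  define M where "M = map_mat complex_of_real A"
  define M' where "M' = (1 / complex_of_real s) \<cdot>\<^sub>m M"
  have M: "M \<in> carrier_mat k k" and M': "M' \<in> carrier_mat k k"
    using A by (simp_all add: M_def M'_def)
  obtain \<mu> where \<mu>: "\<mu> \<in> spectrum M'" "spectral_radius M' = norm \<mu>"
    using spectral_radius_mem_max(1)[OF M' k] by auto
  then obtain x where x: "x \<in> carrier_vec k" "x \<noteq> 0\<^sub>v k" "M' *\<^sub>v x = \<mu> \<cdot>\<^sub>v x"
    using M' by (auto simp: spectrum_def eigenvalue_def eigenvector_def)
  have "M *\<^sub>v x = (of_real s * \<mu>) \<cdot>\<^sub>v x"
  proof -
    have "M *\<^sub>v x = of_real s \<cdot>\<^sub>v (M' *\<^sub>v x)"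
      using M x(1) s0
      by (intro eq_vecI) (auto simp: M'_def scalar_prod_def sum_distrib_left)
    then show ?thesis by (simp add: x(3) smult_smult_assoc)
  qed
  then have "of_real s * \<mu> \<in> spectrum M"
    using M x by (auto simp: spectrum_def eigenvalue_def eigenvector_def)
  then have "norm (of_real s * \<mu>) \<le> rho A"
    using spectral_radius_mem_max(2)[OF M k] by (auto simp: rho_def M_def)
  then have "s * norm \<mu> \<le> rho A" using s0 by (simp add: norm_mult)
  then have "s * norm \<mu> < s * 1" using s by linarith
  then have "norm \<mu> < 1" using s0 by (simp only: mult_less_cancel_left_pos)
  then have "spectral_radius M' < 1" using \<mu>(2) by simp
  from spectral_radius_jnf_norm_bound_less_1_upper_triangular[OF M' this]
  obtain c where c: "\<And>l. norm_bound (M' ^\<^sub>m l) c" by auto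
  have pow: "M' ^\<^sub>m l = (1 / of_real s) ^ l \<cdot>\<^sub>m map_mat of_real (A ^\<^sub>m l)" for l
  proof (induction l)
    case 0
    then show ?case using A by (auto simp: M'_def M_def intro!: eq_matI)
  next
    case (Suc l)
    have Al: "A ^\<^sub>m l \<in> carrier_mat k k" using A by simp
    have "M' ^\<^sub>m Suc l = ((1 / of_real s) ^ l \<cdot>\<^sub>m map_mat of_real (A ^\<^sub>m l)) * ((1 / of_real s) \<cdot>\<^sub>m M)"
      by (simp add: Suc.IH) (simp add: M'_def)
    also have "\<dots> = (1 / of_real s) ^ Suc l \<cdot>\<^sub>m (map_mat of_real (A ^\<^sub>m l) * M)"
      using Al M by (intro eq_matI) (auto simp: scalar_prod_def sum_distrib_left mult_ac)
    also have "map_mat of_real (A ^\<^sub>m l) * M = map_mat of_real (A ^\<^sub>m Suc l)"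
      using Al A by (intro eq_matI) (auto simp: M_def scalar_prod_def)
    finally show ?case .
  qed
  show ?thesis
  proof
    show "0 < max c 1" by simp
    fix l i j assume ij: "i < k" "j < k"
    have "norm ((M' ^\<^sub>m l) $$ (i,j)) \<le> c"
      using c[of l] ij M' by (auto simp: norm_bound_def)
    then have "\<bar>(A ^\<^sub>m l) $$ (i,j)\<bar> / s ^ l \<le> c"
      using ij A s0 by (simp add: pow norm_mult norm_power norm_divide power_one_over)
    then have "\<bar>(A ^\<^sub>m l) $$ (i,j)\<bar> \<le> c * s ^ l" using s0 by (simp add: field_simps)
    also have "\<dots> \<le> max c 1 * s ^ l" using s0 by (intro mult_right_mono) auto
    finally show "\<bar>(A ^\<^sub>m l) $$ (i,j)\<bar> \<le> max c 1 * s ^ l" .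
  qed
qed

section \<open>Nonnegative matrices with positive diagonal\<close>

text \<open>Square nonnegative matrices of size \<open>k\<close> whose diagonal entries are all positive.  They are closed
  under multiplication and dominate a positive multiple of the identity.\<close>

definition nonneg_posdiag :: "nat \<Rightarrow> real mat \<Rightarrow> bool" where
  "nonneg_posdiag k A \<longleftrightarrow> A \<in> carrier_mat k k \<and> 0\<^sub>m k k \<le> A \<and> (\<forall>i<k. 0 < A $$ (i,i))"

lemma nonneg_posdiag_carrier: "nonneg_posdiag k A \<Longrightarrow> A \<in> carrier_mat k k"
  and nonneg_posdiag_nonneg: "nonneg_posdiag k A \<Longrightarrow> 0\<^sub>m k k \<le> A"
  by (simp_all add: nonneg_posdiag_def)

lemma nonneg_posdiag_mult:
  assumes "nonneg_posdiag k A" "nonneg_posdiag k B"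
  shows "nonneg_posdiag k (A * B)"
proof -
  have A: "A \<in> carrier_mat k k" "0\<^sub>m k k \<le> A" and B: "B \<in> carrier_mat k k" "0\<^sub>m k k \<le> B"
    using assms by (simp_all add: nonneg_posdiag_def)
  have "0 < (A * B) $$ (i,i)" if i: "i < k" for i
  proof -
    have "0 < A $$ (i,i) * B $$ (i,i)" using assms i by (simp add: nonneg_posdiag_def)
    also have "\<dots> \<le> (\<Sum>l<k. A $$ (i,l) * B $$ (l,i))"
      by (rule member_le_sum) (use A B i in \<open>auto simp: less_eq_mat_def\<close>)
    also have "\<dots> = (A * B) $$ (i,i)"
      using A B i by (auto simp: scalar_prod_def atLeast0LessThan)
    finally show ?thesis .
  qed
  then show ?thesis
    using A B mult_mat_nonneg[OF A B] by (simp add: nonneg_posdiag_def)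
qed

lemma nonneg_posdiag_ge_scalar:
  assumes "nonneg_posdiag k A"
  obtains c where "0 < c" "c \<cdot>\<^sub>m 1\<^sub>m k \<le> A"
proof -
  define c where "c = Min (insert 1 ((\<lambda>i. A $$ (i,i)) ` {..<k}))"
  have pos: "0 < c" using assms by (auto simp: c_def nonneg_posdiag_def)
  have le: "c \<le> A $$ (i,i)" if "i < k" for i
    unfolding c_def by (rule Min_le) (use that in auto)
  have "c \<cdot>\<^sub>m 1\<^sub>m k \<le> A"
  proof (rule mat_leI)
    fix i j assume "i < k" "j < k"
    then show "(c \<cdot>\<^sub>m 1\<^sub>m k) $$ (i,j) \<le> A $$ (i,j)"
      using le[of i] nonneg_matD[OF nonneg_posdiag_nonneg[OF assms], of i j]
      by (cases "i = j") simp_all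
  qed (use assms in \<open>simp_all add: nonneg_posdiag_def\<close>)
  with pos show thesis by (rule that)
qed

section \<open>Doubling identities\<close>

text \<open>The two identities for \<open>\<Phi>\<close> survive a doubling step, with \<open>T\<close> replaced by its square.  Exchanging
  the roles of the two dimensions gives the identities for \<open>\<Psi>\<close>.\<close>

lemma doubling_step_identities:
  fixes E F G H \<Phi> T U V :: "real mat"
  assumes car: "E \<in> carrier_mat n n" "F \<in> carrier_mat m m" "G \<in> carrier_mat n m"
      "H \<in> carrier_mat m n" "\<Phi> \<in> carrier_mat m n" "T \<in> carrier_mat n n"
      "U \<in> carrier_mat n n" "V \<in> carrier_mat m m"
    and E: "E = (1\<^sub>m n - G * \<Phi>) * T" and H: "\<Phi> - H = F * \<Phi> * T"
    and U: "U * (1\<^sub>m n - G * H) = 1\<^sub>m n" and V: "V * (1\<^sub>m m - H * G) = 1\<^sub>m m"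
  shows "E * U * E = (1\<^sub>m n - (G + E * U * G * F) * \<Phi>) * (T * T)"
    and "\<Phi> - (H + F * V * H * E) = (F * V * F) * \<Phi> * (T * T)"
proof -
  note dims = car[THEN carrier_matD(1)] car[THEN carrier_matD(2)]
  note alg = mat_dim_algebra dims
  have h1: "E * U * G * (\<Phi> - H) * T = E * U * G * (F * \<Phi> * T) * T" by (simp only: H)
  have h2: "E * (U * (1\<^sub>m n - G * H)) * T = E * 1\<^sub>m n * T" by (simp only: U)
  have h3: "E * U * ((1\<^sub>m n - G * \<Phi>) * T) = E * U * E" by (simp only: E[symmetric])
  have h4: "(1\<^sub>m n - G * \<Phi>) * T * T = E * T" by (simp only: E[symmetric])
  show "E * U * E = (1\<^sub>m n - (G + E * U * G * F) * \<Phi>) * (T * T)"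
  proof (rule eq_matI)
    fix i j assume "i < dim_row ((1\<^sub>m n - (G + E * U * G * F) * \<Phi>) * (T * T))"
      "j < dim_col ((1\<^sub>m n - (G + E * U * G * F) * \<Phi>) * (T * T))"
    then have ij: "i < n" "j < n" by (simp_all add: dims)
    show "(E * U * E) $$ (i,j) = ((1\<^sub>m n - (G + E * U * G * F) * \<Phi>) * (T * T)) $$ (i,j)"
      using h1[THEN mat_entry_cong, of i j] h2[THEN mat_entry_cong, of i j]
        h3[THEN mat_entry_cong, of i j] h4[THEN mat_entry_cong, of i j]
      by (simp only: alg ij index_add_mat index_minus_mat index_smult_mat
        index_mult_mat(2,3) index_zero_mat index_one_mat)
  qed (simp_all add: dims)
  have k1: "F * V * (\<Phi> - H) * T = F * V * (F * \<Phi> * T) * T" by (simp only: H)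
  have k2: "F * V * H * ((1\<^sub>m n - G * \<Phi>) * T) = F * V * H * E" by (simp only: E[symmetric])
  have k3: "F * (V * (1\<^sub>m m - H * G)) * \<Phi> * T = F * 1\<^sub>m m * \<Phi> * T" by (simp only: V)
  show "\<Phi> - (H + F * V * H * E) = (F * V * F) * \<Phi> * (T * T)"
  proof (rule eq_matI)
    fix i j assume "i < dim_row ((F * V * F) * \<Phi> * (T * T))"
      "j < dim_col ((F * V * F) * \<Phi> * (T * T))"
    then have ij: "i < m" "j < n" by (simp_all add: dims)
    show "(\<Phi> - (H + F * V * H * E)) $$ (i,j) = ((F * V * F) * \<Phi> * (T * T)) $$ (i,j)"
      using k1[THEN mat_entry_cong, of i j] k2[THEN mat_entry_cong, of i j]
        k3[THEN mat_entry_cong, of i j] H[THEN mat_entry_cong, of i j]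
      by (simp only: alg ij index_add_mat index_minus_mat index_smult_mat
        index_mult_mat(2,3) index_zero_mat index_one_mat)
  qed (simp_all add: dims)
qed

text \<open>The four equations \<open>e1\<close>-\<open>e4\<close> are the blocks of the linear system that defines the initial
  matrices, and \<open>inj\<close> says that its coefficient matrix is injective.  The residuals \<open>X\<close> and \<open>Y\<close> of
  the two claims satisfy the homogeneous system.\<close>

lemma doubling_initial_identities:
  fixes A B C D E F G H \<Phi> T :: "real mat"
  assumes car: "A \<in> carrier_mat m m" "B \<in> carrier_mat m n" "C \<in> carrier_mat n m"
      "D \<in> carrier_mat n n" "E \<in> carrier_mat n n" "F \<in> carrier_mat m m" "G \<in> carrier_mat n m"
      "H \<in> carrier_mat m n" "\<Phi> \<in> carrier_mat m n" "T \<in> carrier_mat n n"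
    and e1: "(D + \<alpha> \<cdot>\<^sub>m 1\<^sub>m n) * E + C * H = D - \<beta> \<cdot>\<^sub>m 1\<^sub>m n"
    and e2: "(D + \<alpha> \<cdot>\<^sub>m 1\<^sub>m n) * G + C * F = C"
    and e3: "B * E + (A + \<beta> \<cdot>\<^sub>m 1\<^sub>m m) * H = B"
    and e4: "B * G + (A + \<beta> \<cdot>\<^sub>m 1\<^sub>m m) * F = A - \<alpha> \<cdot>\<^sub>m 1\<^sub>m m"
    and inj: "\<And>X Y. X \<in> carrier_mat n n \<Longrightarrow> Y \<in> carrier_mat m n \<Longrightarrow>
      (D + \<alpha> \<cdot>\<^sub>m 1\<^sub>m n) * X = C * Y \<Longrightarrow> (A + \<beta> \<cdot>\<^sub>m 1\<^sub>m m) * Y = B * X \<Longrightarrow>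
      X = 0\<^sub>m n n \<and> Y = 0\<^sub>m m n"
    and ric: "\<Phi> * C * \<Phi> - \<Phi> * D - A * \<Phi> + B = 0\<^sub>m m n"
    and T: "((D - C * \<Phi>) + \<alpha> \<cdot>\<^sub>m 1\<^sub>m n) * T = (D - C * \<Phi>) - \<beta> \<cdot>\<^sub>m 1\<^sub>m n"
  shows "E = (1\<^sub>m n - G * \<Phi>) * T" and "\<Phi> - H = F * \<Phi> * T"
proof -
  note dims = car[THEN carrier_matD(1)] car[THEN carrier_matD(2)]
  note alg = mat_dim_algebra dims
  define X where "X = (1\<^sub>m n - G * \<Phi>) * T - E"
  define Y where "Y = F * \<Phi> * T - (\<Phi> - H)"
  have X: "X \<in> carrier_mat n n" and Y: "Y \<in> carrier_mat m n"
    by (simp_all add: X_def Y_def carrier_matI dims)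
  have h1: "((D + \<alpha> \<cdot>\<^sub>m 1\<^sub>m n) * G + C * F) * \<Phi> * T = C * \<Phi> * T" by (simp only: e2)
  have h2: "(B * G + (A + \<beta> \<cdot>\<^sub>m 1\<^sub>m m) * F) * \<Phi> * T = (A - \<alpha> \<cdot>\<^sub>m 1\<^sub>m m) * \<Phi> * T"
    by (simp only: e4)
  have h3: "(\<Phi> * C * \<Phi> - \<Phi> * D - A * \<Phi> + B) * T = 0\<^sub>m m n * T" by (simp only: ric)
  have h4: "\<Phi> * (((D - C * \<Phi>) + \<alpha> \<cdot>\<^sub>m 1\<^sub>m n) * T) = \<Phi> * ((D - C * \<Phi>) - \<beta> \<cdot>\<^sub>m 1\<^sub>m n)"
    by (simp only: T)
  have z: "0\<^sub>m m n * T = 0\<^sub>m m n" using car by simp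
  have XY: "(D + \<alpha> \<cdot>\<^sub>m 1\<^sub>m n) * X = C * Y"
  proof (rule eq_matI)
    fix i j assume "i < dim_row (C * Y)" "j < dim_col (C * Y)"
    then have ij: "i < n" "j < n" using X Y by (simp_all add: dims)
    show "((D + \<alpha> \<cdot>\<^sub>m 1\<^sub>m n) * X) $$ (i,j) = (C * Y) $$ (i,j)"
      using h1[THEN mat_entry_cong, of i j] e1[THEN mat_entry_cong, of i j]
        T[THEN mat_entry_cong, of i j]
      by (simp only: X_def Y_def alg ij index_add_mat index_minus_mat index_smult_mat
        index_mult_mat(2,3) index_zero_mat index_one_mat)
  qed (use X Y in \<open>simp_all add: dims\<close>)
  have YX: "(A + \<beta> \<cdot>\<^sub>m 1\<^sub>m m) * Y = B * X"
  proof (rule eq_matI)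
    fix i j assume "i < dim_row (B * X)" "j < dim_col (B * X)"
    then have ij: "i < m" "j < n" using X Y by (simp_all add: dims)
    show "((A + \<beta> \<cdot>\<^sub>m 1\<^sub>m m) * Y) $$ (i,j) = (B * X) $$ (i,j)"
      using h2[THEN mat_entry_cong, of i j] h3[unfolded z, THEN mat_entry_cong, of i j]
        h4[THEN mat_entry_cong, of i j] e3[THEN mat_entry_cong, of i j]
        ric[THEN mat_entry_cong, of i j]
      by (simp only: X_def Y_def alg ij index_add_mat index_minus_mat index_smult_mat
        index_mult_mat(2,3) index_zero_mat index_one_mat)
  qed (use X Y in \<open>simp_all add: dims\<close>)
  from inj[OF X Y XY YX] have X0: "X = 0\<^sub>m n n" and Y0: "Y = 0\<^sub>m m n" by auto
  show "E = (1\<^sub>m n - G * \<Phi>) * T"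
  proof (rule eq_matI)
    fix i j assume "i < dim_row ((1\<^sub>m n - G * \<Phi>) * T)" "j < dim_col ((1\<^sub>m n - G * \<Phi>) * T)"
    then show "E $$ (i,j) = ((1\<^sub>m n - G * \<Phi>) * T) $$ (i,j)"
      using X0[unfolded X_def, THEN mat_entry_cong, of i j]
      by (simp add: dims del: index_mult_mat(1))
  qed (simp_all add: dims)
  show "\<Phi> - H = F * \<Phi> * T"
  proof (rule eq_matI)
    fix i j assume "i < dim_row (F * \<Phi> * T)" "j < dim_col (F * \<Phi> * T)"
    then show "(\<Phi> - H) $$ (i,j) = (F * \<Phi> * T) $$ (i,j)"
      using Y0[unfolded Y_def, THEN mat_entry_cong, of i j]
      by (simp add: dims del: index_mult_mat(1) assoc_mult_mat)
  qed (simp_all add: dims)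
qed

section \<open>Positive supersolutions of the Riccati equation\<close>

lemma tendsto_mult_mat_entry:
  fixes X Y :: "nat \<Rightarrow> real mat"
  assumes "\<And>k. X k \<in> carrier_mat p q" "\<And>k. Y k \<in> carrier_mat q r"
      "X' \<in> carrier_mat p q" "Y' \<in> carrier_mat q r"
    and X: "\<And>i j. i < p \<Longrightarrow> j < q \<Longrightarrow> (\<lambda>k. X k $$ (i,j)) \<longlonglongrightarrow> X' $$ (i,j)"
    and Y: "\<And>i j. i < q \<Longrightarrow> j < r \<Longrightarrow> (\<lambda>k. Y k $$ (i,j)) \<longlonglongrightarrow> Y' $$ (i,j)"
    and ij: "i < p" "j < r"
  shows "(\<lambda>k. (X k * Y k) $$ (i,j)) \<longlonglongrightarrow> (X' * Y') $$ (i,j)"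
proof -
  have "(\<lambda>k. \<Sum>l<q. X k $$ (i,l) * Y k $$ (l,j)) \<longlonglongrightarrow> (\<Sum>l<q. X' $$ (i,l) * Y' $$ (l,j))"
    by (intro tendsto_sum tendsto_mult X Y) (use ij in auto)
  then show ?thesis
    by (simp only: mult_mat_entry[OF assms(1,2) ij] mult_mat_entry[OF assms(3,4) ij])
qed

text \<open>The Riccati equation is equivalent to the fixed-point equation
  \<open>(\<alpha> + \<beta>) X = X C X + X (\<beta>I - D) + (\<alpha>I - A) X + B\<close>, in which all coefficients are
  nonnegative.  Iterating from zero gives an increasing sequence that stays below \<open>v2\<close> when
  applied to \<open>v1\<close>; its limit is a nonnegative solution, and so lies above \<open>\<Phi>\<close>.\<close>

lemma min_solution_le_positive_vec:
  fixes A B C D :: "real mat"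
  assumes car: "A \<in> carrier_mat m m" "B \<in> carrier_mat m n" "C \<in> carrier_mat n m" "D \<in> carrier_mat n n"
    and nonneg: "0\<^sub>m m n \<le> B" "0\<^sub>m n m \<le> C" "0\<^sub>m m m \<le> \<alpha> \<cdot>\<^sub>m 1\<^sub>m m - A" "0\<^sub>m n n \<le> \<beta> \<cdot>\<^sub>m 1\<^sub>m n - D"
    and pos: "0 \<le> \<beta>" "0 < \<alpha> + \<beta>"
    and v1: "v1 \<in> carrier_vec n" "\<And>j. j < n \<Longrightarrow> 0 < v1 $ j"
    and v2: "v2 \<in> carrier_vec m" "\<And>i. i < m \<Longrightarrow> 0 < v2 $ i"
    and super: "C *\<^sub>v v2 \<le> D *\<^sub>v v1" "B *\<^sub>v v1 \<le> A *\<^sub>v v2"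
    and min: "min_nonneg_solution m n (\<lambda>X. X * C * X - X * D - A * X + B = 0\<^sub>m m n) \<Phi>"
  shows "\<Phi> *\<^sub>v v1 \<le> v2"
proof -
  define A' where "A' = \<alpha> \<cdot>\<^sub>m 1\<^sub>m m - A"
  define D' where "D' = \<beta> \<cdot>\<^sub>m 1\<^sub>m n - D"
  \<comment> \<open>The iteration is \<open>X \<mapsto> f X / (\<alpha> + \<beta>)\<close>; \<open>f\<close> is monotone on nonnegative matrices.\<close>
  define f where "f X = X * (C * X) + X * D' + (A' * X + B)" for X
  have A': "A' \<in> carrier_mat m m" "0\<^sub>m m m \<le> A'" and D': "D' \<in> carrier_mat n n" "0\<^sub>m n n \<le> D'"
    using car nonneg by (auto simp: A'_def D'_def minus_carrier_mat)
  have v0: "0\<^sub>v n \<le> v1" "0\<^sub>v m \<le> v2" using v1 v2 by (auto simp: less_eq_vec_def less_imp_le)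
  have fc: "f X \<in> carrier_mat m n" if "X \<in> carrier_mat m n" for X
    using that car A' D' by (simp add: f_def)
  have mono: "f X \<le> f Y" if X: "X \<in> carrier_mat m n" "0\<^sub>m m n \<le> X" "X \<le> Y" for X Y
  proof -
    have "C * X \<le> C * Y" by (rule mult_mat_mono[OF car(3) nonneg(2) order_refl X])
    then have "X * (C * X) \<le> Y * (C * Y)"
      using mult_mat_nonneg[OF car(3) nonneg(2) X(1,2)] car X by (intro mult_mat_mono[OF X]) auto
    moreover have "X * D' \<le> Y * D'" by (rule mult_mat_mono[OF X D' order_refl])
    moreover have "A' * X \<le> A' * Y" by (rule mult_mat_mono[OF A' order_refl X])
    ultimately show ?thesis
      unfolding f_def using X car A' D' by (intro add_mat_mono[of _ m n]) auto
  qed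
  have fnonneg: "0\<^sub>m m n \<le> f X" if X: "X \<in> carrier_mat m n" "0\<^sub>m m n \<le> X" for X
    unfolding f_def
    by (intro add_mat_nonneg mult_mat_nonneg[OF X] mult_mat_nonneg[OF A' X] D' nonneg
      mult_mat_nonneg[OF car(3) nonneg(2) X] mult_carrier_mat[OF car(3) X(1)])
  have bound: "f X *\<^sub>v v1 \<le> (\<alpha> + \<beta>) \<cdot>\<^sub>v v2"
    if X: "X \<in> carrier_mat m n" "0\<^sub>m m n \<le> X" "X *\<^sub>v v1 \<le> v2" for X
  proof (rule vec_leI)
    have Xv: "X *\<^sub>v v1 \<in> carrier_vec m" "0\<^sub>v m \<le> X *\<^sub>v v1"
      using X v1 mult_mat_nonneg_vec[OF X(1,2) v1(1) v0(1)] by auto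
    have CX: "C *\<^sub>v (X *\<^sub>v v1) \<le> C *\<^sub>v v2"
      by (rule mult_mat_vec_mono[OF car(3) nonneg(2) order_refl Xv X(3)])
    have CX0: "0\<^sub>v n \<le> C *\<^sub>v (X *\<^sub>v v1)" by (rule mult_mat_nonneg_vec[OF car(3) nonneg(2) Xv])
    have D0: "0\<^sub>v n \<le> D' *\<^sub>v v1" by (rule mult_mat_nonneg_vec[OF D' v1(1) v0(1)])
    define u where "u = C *\<^sub>v (X *\<^sub>v v1) + D' *\<^sub>v v1"
    have u: "u \<in> carrier_vec n" using car Xv D' v1 by (simp add: u_def)
    have carr: "C *\<^sub>v v2 \<in> carrier_vec n" "C *\<^sub>v (X *\<^sub>v v1) \<in> carrier_vec n"
        "A' *\<^sub>v (X *\<^sub>v v1) \<in> carrier_vec m" "B *\<^sub>v v1 \<in> carrier_vec m" "X *\<^sub>v u \<in> carrier_vec m"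
      using car Xv A' X u v1 v2 by simp_all
    have u0: "0\<^sub>v n \<le> u"
      by (rule vec_leI[of _ n])
        (use u nonneg_vecD[OF CX0] nonneg_vecD[OF D0] car D' in \<open>auto simp: u_def simp del: index_mult_mat_vec\<close>)
    have Dv: "(D' *\<^sub>v v1) $ i = \<beta> * v1 $ i - (D *\<^sub>v v1) $ i" if "i < n" for i
    proof -
      have "D' *\<^sub>v v1 = (\<beta> \<cdot>\<^sub>m 1\<^sub>m n) *\<^sub>v v1 - D *\<^sub>v v1"
        unfolding D'_def by (rule minus_mult_distrib_mat_vec) (use car v1 in auto)
      moreover have "(\<beta> \<cdot>\<^sub>m 1\<^sub>m n) *\<^sub>v v1 = \<beta> \<cdot>\<^sub>v v1"
        by (rule scalar_mat_mult_vec[OF v1(1)])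
      ultimately show ?thesis using car v1(1) that by (simp del: index_mult_mat_vec)
    qed
    have Av: "(A' *\<^sub>v v2) $ i = \<alpha> * v2 $ i - (A *\<^sub>v v2) $ i" if "i < m" for i
    proof -
      have "A' *\<^sub>v v2 = (\<alpha> \<cdot>\<^sub>m 1\<^sub>m m) *\<^sub>v v2 - A *\<^sub>v v2"
        unfolding A'_def by (rule minus_mult_distrib_mat_vec) (use car v2 in auto)
      moreover have "(\<alpha> \<cdot>\<^sub>m 1\<^sub>m m) *\<^sub>v v2 = \<alpha> \<cdot>\<^sub>v v2"
        by (rule scalar_mat_mult_vec[OF v2(1)])
      ultimately show ?thesis using car v2(1) that by (simp del: index_mult_mat_vec)
    qed
    have u\<beta>: "u \<le> \<beta> \<cdot>\<^sub>v v1"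
    proof (rule vec_leI[OF u])
      fix i assume i: "i < n"
      show "u $ i \<le> (\<beta> \<cdot>\<^sub>v v1) $ i"
        using vec_leD[OF CX, of n i] vec_leD[OF super(1), of n i] Dv[OF i] car D' v1 i carr
        by (simp add: u_def del: index_mult_mat_vec)
    qed (use v1 in auto)
    have Xu: "X *\<^sub>v u \<le> X *\<^sub>v (\<beta> \<cdot>\<^sub>v v1)"
      by (rule mult_mat_vec_mono[OF X(1,2) order_refl u u0 u\<beta>])
    have X\<beta>: "X *\<^sub>v (\<beta> \<cdot>\<^sub>v v1) = \<beta> \<cdot>\<^sub>v (X *\<^sub>v v1)" using X v1 by (simp add: mult_mat_vec)
    have AX: "A' *\<^sub>v (X *\<^sub>v v1) \<le> A' *\<^sub>v v2"
      by (rule mult_mat_vec_mono[OF A' order_refl Xv X(3)])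
    have f_eq: "f X *\<^sub>v v1 = X *\<^sub>v u + (A' *\<^sub>v (X *\<^sub>v v1) + B *\<^sub>v v1)"
    proof -
      have "f X *\<^sub>v v1 = (X * (C * X) + X * D') *\<^sub>v v1 + (A' * X + B) *\<^sub>v v1"
        unfolding f_def by (rule add_mult_distrib_mat_vec) (use X car A' D' v1 in auto)
      also have "(X * (C * X) + X * D') *\<^sub>v v1 = (X * (C * X)) *\<^sub>v v1 + (X * D') *\<^sub>v v1"
        by (rule add_mult_distrib_mat_vec) (use X car A' D' v1 in auto)
      also have "\<dots> = X *\<^sub>v (C *\<^sub>v (X *\<^sub>v v1)) + X *\<^sub>v (D' *\<^sub>v v1)"
        using X car D' v1 by (simp add: assoc_mult_mat_vec[of _ m n _ n] assoc_mult_mat_vec[of _ n m _ n])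
      also have "\<dots> = X *\<^sub>v u" unfolding u_def
        by (rule mult_add_distrib_mat_vec[symmetric]) (use X car D' v1 Xv in auto)
      also have "(A' * X + B) *\<^sub>v v1 = (A' * X) *\<^sub>v v1 + B *\<^sub>v v1"
        by (rule add_mult_distrib_mat_vec) (use X car A' D' v1 in auto)
      also have "(A' * X) *\<^sub>v v1 = A' *\<^sub>v (X *\<^sub>v v1)"
        using A' X v1 by (simp add: assoc_mult_mat_vec[of _ m m _ n])
      finally show ?thesis .
    qed
    fix i assume i: "i < m"
    have "\<beta> * (X *\<^sub>v v1) $ i \<le> \<beta> * v2 $ i"
      using pos(1) vec_leD[OF X(3) Xv(1) i] by (intro mult_left_mono) auto
    then show "(f X *\<^sub>v v1) $ i \<le> ((\<alpha> + \<beta>) \<cdot>\<^sub>v v2) $ i"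
      using vec_leD[OF Xu[unfolded X\<beta>], of m i] vec_leD[OF AX, of m i] vec_leD[OF super(2), of m i] Av[OF i]
        X A' car v1 v2 i carr
      by (simp add: f_eq algebra_simps del: index_mult_mat_vec)
  qed (use fc[OF X(1)] v1 v2 in auto)
  define X where "X k = ((\<lambda>Z. (1 / (\<alpha> + \<beta>)) \<cdot>\<^sub>m f Z) ^^ k) (0\<^sub>m m n)" for k
  have X_Suc: "X (Suc k) = (1 / (\<alpha> + \<beta>)) \<cdot>\<^sub>m f (X k)" for k by (simp add: X_def)
  have smult_nonneg: "0\<^sub>m m n \<le> (1 / (\<alpha> + \<beta>)) \<cdot>\<^sub>m Z" if "0\<^sub>m m n \<le> Z" for Z
    by (rule mat_leI[of _ m n]) (use that pos nonneg_matD[OF that] mat_le_carrier[OF that zero_carrier_mat] in auto)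
  have X: "X k \<in> carrier_mat m n \<and> 0\<^sub>m m n \<le> X k \<and> X k *\<^sub>v v1 \<le> v2" for k
  proof (induction k)
    case 0
    have "0\<^sub>m m n *\<^sub>v v1 = 0\<^sub>v m" using v1 by (intro eq_vecI) auto
    then show ?case using v0 by (simp add: X_def)
  next
    case (Suc k)
    then have f: "f (X k) \<in> carrier_mat m n" "0\<^sub>m m n \<le> f (X k)"
        "f (X k) *\<^sub>v v1 \<le> (\<alpha> + \<beta>) \<cdot>\<^sub>v v2"
      using fc fnonneg bound by auto
    have "X (Suc k) *\<^sub>v v1 \<le> v2"
    proof (rule vec_leI)
      fix i assume i: "i < m"
      have "(X (Suc k) *\<^sub>v v1) $ i = (1 / (\<alpha> + \<beta>)) * (f (X k) *\<^sub>v v1) $ i"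
        using f(1) v1(1) i by (simp add: X_Suc)
      also have "\<dots> \<le> v2 $ i"
        using vec_leD[OF f(3), of m i] f(1) v1(1) v2(1) i pos
        by (simp add: divide_le_eq mult.commute del: index_mult_mat_vec)
      finally show "(X (Suc k) *\<^sub>v v1) $ i \<le> v2 $ i" .
    qed (use mult_mat_vec_carrier[OF smult_carrier_mat[OF f(1)] v1(1)] v2 in \<open>auto simp: X_Suc\<close>)
    then show ?case using f smult_nonneg by (simp add: X_Suc)
  qed
  have Xc: "X k \<in> carrier_mat m n" and X0: "0\<^sub>m m n \<le> X k" for k using X by auto
  have Xv: "(X k *\<^sub>v v1) $ i \<le> v2 $ i" if "i < m" for k i
    by (rule vec_leD[OF _ mult_mat_vec_carrier[OF Xc v1(1)] that]) (use X in blast)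
  have inc: "X k \<le> X (Suc k)" for k
  proof (induction k)
    case 0
    then show ?case using X0[of 1] by (simp add: X_def)
  next
    case (Suc k)
    have le: "f (X k) \<le> f (X (Suc k))" by (rule mono[OF Xc X0 Suc])
    show ?case
    proof (rule mat_leI[OF Xc Xc])
      fix i j assume ij: "i < m" "j < n"
      have e: "X (Suc l) $$ (i,j) = f (X l) $$ (i,j) / (\<alpha> + \<beta>)" for l
        using fc[OF Xc[of l]] ij by (simp add: X_Suc)
      show "X (Suc k) $$ (i,j) \<le> X (Suc (Suc k)) $$ (i,j)"
        unfolding e using mat_leD[OF le fc[OF Xc] ij] pos by (intro divide_right_mono) auto
    qed
  qed
  define L where "L = mat m n (\<lambda>(i,j). lim (\<lambda>k. X k $$ (i,j)))"
  have Lc: "L \<in> carrier_mat m n" by (simp add: L_def)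
  have bnd: "X k $$ (i,j) * v1 $ j \<le> v2 $ i" if ij: "i < m" "j < n" for k i j
  proof -
    have "X k $$ (i,j) * v1 $ j \<le> (\<Sum>l<n. X k $$ (i,l) * v1 $ l)"
      by (rule member_le_sum)
        (use ij nonneg_matD[OF X0[of k] ij(1)] nonneg_vecD[OF v0(1)] in \<open>auto intro!: mult_nonneg_nonneg\<close>)
    also have "\<dots> = (X k *\<^sub>v v1) $ i"
      by (rule mult_mat_vec_entry[OF Xc v1(1) ij(1), symmetric])
    also have "\<dots> \<le> v2 $ i" by (rule Xv[OF ij(1)])
    finally show ?thesis .
  qed
  have lim: "(\<lambda>k. X k $$ (i,j)) \<longlonglongrightarrow> L $$ (i,j)" if ij: "i < m" "j < n" for i j
  proof -
    have "incseq (\<lambda>k. X k $$ (i,j))"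
      by (rule incseq_SucI) (rule mat_leD[OF inc Xc ij])
    moreover have "X k $$ (i,j) \<le> v2 $ i / v1 $ j" for k
      using bnd[OF ij, of k] v1(2)[OF ij(2)] by (simp add: pos_le_divide_eq)
    ultimately have "convergent (\<lambda>k. X k $$ (i,j))"
      by (meson convergentI incseq_convergent)
    then show ?thesis using ij by (simp add: L_def convergent_LIMSEQ_iff)
  qed
  have L0: "0\<^sub>m m n \<le> L"
  proof (rule mat_leI[of _ m n])
    fix i j assume ij: "i < m" "j < n"
    show "0\<^sub>m m n $$ (i,j) \<le> L $$ (i,j)"
      using LIMSEQ_le_const[OF lim[OF ij], of 0] nonneg_matD[OF X0 ij] ij by auto
  qed (use Lc in auto)
  have limf: "(\<lambda>k. f (X k) $$ (i,j)) \<longlonglongrightarrow> f L $$ (i,j)" if ij: "i < m" "j < n" for i j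
  proof -
    have CX: "(\<lambda>k. (C * X k) $$ (a,b)) \<longlonglongrightarrow> (C * L) $$ (a,b)" if "a < n" "b < n" for a b
      by (rule tendsto_mult_mat_entry[OF car(3) Xc car(3) Lc tendsto_const lim that])
    have 1: "(\<lambda>k. (X k * (C * X k)) $$ (i,j)) \<longlonglongrightarrow> (L * (C * L)) $$ (i,j)"
      by (rule tendsto_mult_mat_entry[OF Xc mult_carrier_mat[OF car(3) Xc] Lc
            mult_carrier_mat[OF car(3) Lc] lim CX ij])
    have 2: "(\<lambda>k. (X k * D') $$ (i,j)) \<longlonglongrightarrow> (L * D') $$ (i,j)"
      by (rule tendsto_mult_mat_entry[OF Xc D'(1) Lc D'(1) lim tendsto_const ij])
    have 3: "(\<lambda>k. (A' * X k) $$ (i,j)) \<longlonglongrightarrow> (A' * L) $$ (i,j)"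
      by (rule tendsto_mult_mat_entry[OF A'(1) Xc A'(1) Lc tendsto_const lim ij])
    have e: "f Z $$ (i,j) = (Z * (C * Z)) $$ (i,j) + (Z * D') $$ (i,j) +
        ((A' * Z) $$ (i,j) + B $$ (i,j))" if "Z \<in> carrier_mat m n" for Z
      using that car A' D' ij by (simp add: f_def del: index_mult_mat(1))
    show ?thesis unfolding e[OF Xc] e[OF Lc]
      by (intro tendsto_add 1 2 3 tendsto_const)
  qed
  have fL: "f L $$ (i,j) = (\<alpha> + \<beta>) * L $$ (i,j)" if ij: "i < m" "j < n" for i j
  proof -
    have "(\<lambda>k. (\<alpha> + \<beta>) * X (Suc k) $$ (i,j)) \<longlonglongrightarrow> (\<alpha> + \<beta>) * L $$ (i,j)"
      by (intro tendsto_mult tendsto_const LIMSEQ_Suc lim ij)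
    moreover have "(\<alpha> + \<beta>) * X (Suc k) $$ (i,j) = f (X k) $$ (i,j)" for k
      using ij fc[OF Xc[of k]] pos by (simp add: X_Suc)
    ultimately show ?thesis using LIMSEQ_unique[OF limf[OF ij]] by simp
  qed
  have sol: "L * C * L - L * D - A * L + B = 0\<^sub>m m n"
  proof (rule eq_matI)
    fix i j assume "i < dim_row (0\<^sub>m m n :: real mat)" "j < dim_col (0\<^sub>m m n :: real mat)"
    then have ij: "i < m" "j < n" by simp_all
    note dims = car[THEN carrier_matD(1)] car[THEN carrier_matD(2)] carrier_matD[OF Lc]
    show "(L * C * L - L * D - A * L + B) $$ (i,j) = 0\<^sub>m m n $$ (i,j)"
      using fL[OF ij] unfolding f_def A'_def D'_def
      by (simp only: mat_dim_algebra dims ij index_add_mat index_minus_mat index_smult_mat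
          index_mult_mat(2,3) index_zero_mat index_one_mat) (simp add: algebra_simps)
  qed (use car Lc in auto)
  have "\<Phi> \<le> L" and \<Phi>: "\<Phi> \<in> carrier_mat m n" "0\<^sub>m m n \<le> \<Phi>"
    using min Lc L0 sol by (auto simp: min_nonneg_solution_def)
  show ?thesis
  proof (rule vec_leI)
    fix i assume i: "i < m"
    have "(\<Phi> *\<^sub>v v1) $ i = (\<Sum>l<n. \<Phi> $$ (i,l) * v1 $ l)"
      by (rule mult_mat_vec_entry[OF \<Phi>(1) v1(1) i])
    also have "\<dots> \<le> (\<Sum>l<n. L $$ (i,l) * v1 $ l)"
      using mat_leD[OF \<open>\<Phi> \<le> L\<close> \<Phi>(1) i] v1(2)
      by (intro sum_mono mult_right_mono) (auto intro: less_imp_le)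
    also have "\<dots> \<le> v2 $ i"
    proof (rule LIMSEQ_le_const2)
      show "(\<lambda>k. \<Sum>l<n. X k $$ (i,l) * v1 $ l) \<longlonglongrightarrow> (\<Sum>l<n. L $$ (i,l) * v1 $ l)"
        by (intro tendsto_sum tendsto_mult tendsto_const lim i) simp
      have "(\<Sum>l<n. X k $$ (i,l) * v1 $ l) \<le> v2 $ i" for k
        using Xv[OF i, of k] by (simp only: mult_mat_vec_entry[OF Xc v1(1) i])
      then show "\<exists>N. \<forall>k\<ge>N. (\<Sum>l<n. X k $$ (i,l) * v1 $ l) \<le> v2 $ i" by blast
    qed
    finally show "(\<Phi> *\<^sub>v v1) $ i \<le> v2 $ i" .
  qed (use \<Phi> v1 v2 in auto)
qed

section \<open>The invariant of the doubling step\<close>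

text \<open>The invariant of the doubling iteration.  Here \<open>T\<close> and \<open>U\<close> stand for the current powers of the two
  closed-loop matrices.  All matrices are nonnegative; at the start of the iteration this
  requires \<open>E\<close>, \<open>F\<close>, \<open>T\<close> and \<open>U\<close> to be taken with the opposite sign, which affects neither the
  identities nor the next iterate.\<close>

definition doubling_state ::
    "nat \<Rightarrow> nat \<Rightarrow> real mat \<Rightarrow> real mat \<Rightarrow> real mat \<Rightarrow> real mat \<Rightarrow>
     real mat \<Rightarrow> real mat \<Rightarrow> real mat \<Rightarrow> real mat \<Rightarrow> bool" where
  "doubling_state n m \<Phi> \<Psi> T U E F G H \<longleftrightarrow>
     nonneg_posdiag n E \<and> nonneg_posdiag m F \<and> nonneg_posdiag n T \<and> nonneg_posdiag m U \<and>
     G \<in> carrier_mat n m \<and> 0\<^sub>m n m \<le> G \<and> H \<in> carrier_mat m n \<and> 0\<^sub>m m n \<le> H \<and>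
     E = (1\<^sub>m n - G * \<Phi>) * T \<and> \<Phi> - H = F * \<Phi> * T \<and>
     F = (1\<^sub>m m - H * \<Psi>) * U \<and> \<Psi> - G = E * \<Psi> * U"

lemma doubling_state_swap:
  "doubling_state n m \<Phi> \<Psi> T U E F G H \<Longrightarrow> doubling_state m n \<Psi> \<Phi> U T F E H G"
  unfolding doubling_state_def by blast

text \<open>As \<open>F\<close> and \<open>T\<close> dominate positive multiples of the identity, \<open>\<Phi> - H = F * \<Phi> * T\<close> dominates a
  positive multiple of \<open>\<Phi>\<close>.\<close>

lemma doubling_state_H_contraction:
  assumes st: "doubling_state n m \<Phi> \<Psi> T U E F G H"
    and \<Phi>: "\<Phi> \<in> carrier_mat m n" "0\<^sub>m m n \<le> \<Phi>"
  obtains c where "0 < c" "c \<le> 1" "H \<le> (1 - c) \<cdot>\<^sub>m \<Phi>"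
proof -
  have F: "nonneg_posdiag m F" and T: "nonneg_posdiag n T" and H: "H \<in> carrier_mat m n"
    and eq: "\<Phi> - H = F * \<Phi> * T" using st unfolding doubling_state_def by blast+
  obtain c1 where c1: "0 < c1" "c1 \<cdot>\<^sub>m 1\<^sub>m m \<le> F" using nonneg_posdiag_ge_scalar[OF F] .
  obtain c2 where c2: "0 < c2" "c2 \<cdot>\<^sub>m 1\<^sub>m n \<le> T" using nonneg_posdiag_ge_scalar[OF T] .
  have nn: "0\<^sub>m k k \<le> d \<cdot>\<^sub>m 1\<^sub>m k" if "0 < d" for k and d :: real
    by (rule mat_leI[of _ k k]) (use that in auto)
  have "(c1 \<cdot>\<^sub>m 1\<^sub>m m) * \<Phi> * (c2 \<cdot>\<^sub>m 1\<^sub>m n) \<le> F * \<Phi> * T"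
  proof (rule mult_mat_mono[OF _ _ _ _ nn[OF c2(1)] c2(2)])
    show "(c1 \<cdot>\<^sub>m 1\<^sub>m m) * \<Phi> \<le> F * \<Phi>"
      by (rule mult_mat_mono[OF _ nn[OF c1(1)] c1(2) \<Phi> order_refl]) simp
    show "0\<^sub>m m n \<le> (c1 \<cdot>\<^sub>m 1\<^sub>m m) * \<Phi>"
      by (rule mult_mat_nonneg[OF _ nn[OF c1(1)] \<Phi>]) simp
  qed (use \<Phi> in auto)
  also have "(c1 \<cdot>\<^sub>m 1\<^sub>m m) * \<Phi> * (c2 \<cdot>\<^sub>m 1\<^sub>m n) = (c2 * c1) \<cdot>\<^sub>m \<Phi>"
    using \<Phi>(1) by (simp add: mat_dim_algebra) (auto intro!: eq_matI)
  finally have le: "(c2 * c1) \<cdot>\<^sub>m \<Phi> \<le> \<Phi> - H" unfolding eq .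
  \<comment> \<open>The cap at \<open>1\<close> keeps the factor \<open>1 - c\<close> nonnegative.\<close>
  define c where "c = min 1 (c2 * c1)"
  have "H \<le> (1 - c) \<cdot>\<^sub>m \<Phi>"
  proof (rule mat_leI)
    fix i j assume ij: "i < m" "j < n"
    have "c * \<Phi> $$ (i,j) \<le> (c2 * c1) * \<Phi> $$ (i,j)"
      using nonneg_matD[OF \<Phi>(2) ij] by (intro mult_right_mono) (auto simp: c_def)
    also have "\<dots> \<le> \<Phi> $$ (i,j) - H $$ (i,j)"
      using mat_leD[OF le smult_carrier_mat[OF \<Phi>(1)] ij] \<Phi>(1) H ij by simp
    finally show "H $$ (i,j) \<le> ((1 - c) \<cdot>\<^sub>m \<Phi>) $$ (i,j)"
      using \<Phi>(1) ij by (simp add: algebra_simps)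
  qed (use \<Phi> H in auto)
  with c1 c2 show thesis by (intro that[of c]) (auto simp: c_def)
qed

lemma doubling_state_H_le:
  assumes st: "doubling_state n m \<Phi> \<Psi> T U E F G H"
    and \<Phi>: "\<Phi> \<in> carrier_mat m n" "0\<^sub>m m n \<le> \<Phi>"
  shows "H \<le> \<Phi>"
proof -
  obtain c where c: "0 < c" "H \<le> (1 - c) \<cdot>\<^sub>m \<Phi>"
    using doubling_state_H_contraction[OF assms] by blast
  have H: "H \<in> carrier_mat m n" using st unfolding doubling_state_def by blast
  show ?thesis
  proof (rule mat_leI[OF H \<Phi>(1)])
    fix i j assume ij: "i < m" "j < n"
    have "H $$ (i,j) \<le> (1 - c) * \<Phi> $$ (i,j)" using mat_leD[OF c(2) H ij] \<Phi>(1) ij by simp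
    also have "\<dots> \<le> 1 * \<Phi> $$ (i,j)"
      using nonneg_matD[OF \<Phi>(2) ij] c(1) by (intro mult_right_mono) auto
    finally show "H $$ (i,j) \<le> \<Phi> $$ (i,j)" by simp
  qed
qed

text \<open>Because \<open>H * \<Psi> * U\<close> is nonnegative, \<open>F = U - H * \<Psi> * U\<close> is at most \<open>U\<close>.\<close>

lemma doubling_state_error_le:
  assumes st: "doubling_state n m \<Phi> \<Psi> T U E F G H"
    and \<Phi>: "\<Phi> \<in> carrier_mat m n" "0\<^sub>m m n \<le> \<Phi>" and \<Psi>: "\<Psi> \<in> carrier_mat n m" "0\<^sub>m n m \<le> \<Psi>"
  shows "\<Phi> - H \<le> U * \<Phi> * T"
proof -
  have F: "F \<in> carrier_mat m m" "0\<^sub>m m m \<le> F" and T: "T \<in> carrier_mat n n" "0\<^sub>m n n \<le> T"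
    and U: "U \<in> carrier_mat m m" "0\<^sub>m m m \<le> U"
    and H: "H \<in> carrier_mat m n" "0\<^sub>m m n \<le> H"
    and eq: "\<Phi> - H = F * \<Phi> * T" and Feq: "F = (1\<^sub>m m - H * \<Psi>) * U"
    using st unfolding doubling_state_def nonneg_posdiag_def by blast+
  have "F \<le> U"
  proof (rule mat_leI[OF F(1) U(1)])
    fix i j assume ij: "i < m" "j < m"
    have "0 \<le> (H * \<Psi> * U) $$ (i,j)"
      using mult_mat_nonneg[OF mult_carrier_mat[OF H(1) \<Psi>(1)] mult_mat_nonneg[OF H \<Psi>] U]
        nonneg_matD ij by blast
    moreover have "F = U - H * \<Psi> * U"
      unfolding Feq using H \<Psi> U by (simp add: minus_mult_distrib_mat[of _ m m _ _ m])
    then have "F $$ (i,j) = U $$ (i,j) - (H * \<Psi> * U) $$ (i,j)"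
      using H \<Psi> U ij by (simp del: index_mult_mat(1) assoc_mult_mat)
    ultimately show "F $$ (i,j) \<le> U $$ (i,j)" by simp
  qed
  then have "F * \<Phi> \<le> U * \<Phi>" by (rule mult_mat_mono[OF F _ \<Phi> order_refl])
  then have "F * \<Phi> * T \<le> U * \<Phi> * T"
    using mult_mat_mono[OF mult_carrier_mat[OF F(1) \<Phi>(1)] mult_mat_nonneg[OF F \<Phi>] _ T order_refl] by blast
  then show ?thesis by (simp only: eq)
qed

text \<open>The contraction factor \<open>1 - c\<close> makes \<open>v1\<close> a strictly subinvariant vector of \<open>G * H\<close>, so that
  \<open>1\<^sub>m n - G * H\<close> is a nonsingular M-matrix although \<open>\<Psi> * \<Phi>\<close> may have spectral radius \<open>1\<close>.\<close>

lemma doubling_state_inverse: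
  assumes st: "doubling_state n m \<Phi> \<Psi> T U E F G H" and n: "0 < n"
    and \<Phi>: "\<Phi> \<in> carrier_mat m n" "0\<^sub>m m n \<le> \<Phi>" and \<Psi>: "\<Psi> \<in> carrier_mat n m" "0\<^sub>m n m \<le> \<Psi>"
    and v1: "v1 \<in> carrier_vec n" "\<And>j. j < n \<Longrightarrow> 0 < v1 $ j"
    and v2: "v2 \<in> carrier_vec m" "\<And>i. i < m \<Longrightarrow> 0 < v2 $ i"
    and \<Phi>v: "\<Phi> *\<^sub>v v1 \<le> v2" and \<Psi>v: "\<Psi> *\<^sub>v v2 \<le> v1"
  shows "nonsingular_M_matrix (1\<^sub>m n - G * H)" "invertible_mat (1\<^sub>m n - G * H)"
    "mat_inv (1\<^sub>m n - G * H) * (1\<^sub>m n - G * H) = 1\<^sub>m n"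
    "nonneg_posdiag n (mat_inv (1\<^sub>m n - G * H))"
proof -
  have H: "H \<in> carrier_mat m n" "0\<^sub>m m n \<le> H" and G: "G \<in> carrier_mat n m" "0\<^sub>m n m \<le> G"
    using st unfolding doubling_state_def by blast+
  have GH: "G * H \<in> carrier_mat n n" using G H by simp
  have GH0: "0\<^sub>m n n \<le> G * H" by (rule mult_mat_nonneg[OF G H])
  obtain c where c: "0 < c" "c \<le> 1" "H \<le> (1 - c) \<cdot>\<^sub>m \<Phi>"
    using doubling_state_H_contraction[OF st \<Phi>] .
  have G\<Psi>: "G \<le> \<Psi>" by (rule doubling_state_H_le[OF doubling_state_swap[OF st] \<Psi>])
  have v0: "0\<^sub>v n \<le> v1" using v1 by (auto simp: less_eq_vec_def less_imp_le)
  have Hv: "H *\<^sub>v v1 \<le> (1 - c) \<cdot>\<^sub>v v2"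
  proof (rule vec_leI)
    fix i assume i: "i < m"
    have "(H *\<^sub>v v1) $ i \<le> (((1 - c) \<cdot>\<^sub>m \<Phi>) *\<^sub>v v1) $ i"
      by (rule vec_leD[OF mult_mat_vec_mono[OF H c(3) v1(1) v0 order_refl] _ i]) (use H v1 in simp)
    also have "\<dots> = (1 - c) * (\<Phi> *\<^sub>v v1) $ i" using \<Phi>(1) v1(1) i by simp
    also have "\<dots> \<le> (1 - c) * v2 $ i"
      using c vec_leD[OF \<Phi>v _ i] \<Phi>(1) v1(1) by (intro mult_left_mono) auto
    finally show "(H *\<^sub>v v1) $ i \<le> ((1 - c) \<cdot>\<^sub>v v2) $ i" using v2(1) i by simp
  qed (use H v1 v2 in auto)
  have GHv: "(G * H) *\<^sub>v v1 \<le> (1 - c) \<cdot>\<^sub>v v1"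
  proof -
    have "(G * H) *\<^sub>v v1 = G *\<^sub>v (H *\<^sub>v v1)" by (rule assoc_mult_mat_vec[OF G(1) H(1) v1(1)])
    also have "\<dots> \<le> \<Psi> *\<^sub>v ((1 - c) \<cdot>\<^sub>v v2)"
      by (rule mult_mat_vec_mono[OF G G\<Psi> _ mult_mat_nonneg_vec[OF H v1(1) v0] Hv]) (use H v1 in simp)
    also have "\<dots> = (1 - c) \<cdot>\<^sub>v (\<Psi> *\<^sub>v v2)" by (rule mult_mat_vec[OF \<Psi>(1) v2(1)])
    also have "\<dots> \<le> (1 - c) \<cdot>\<^sub>v v1"
    proof (rule vec_leI)
      fix i assume i: "i < n"
      have "(1 - c) * (\<Psi> *\<^sub>v v2) $ i \<le> (1 - c) * v1 $ i"
        using c vec_leD[OF \<Psi>v _ i] \<Psi>(1) v2(1) by (intro mult_left_mono) auto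
      then show "((1 - c) \<cdot>\<^sub>v (\<Psi> *\<^sub>v v2)) $ i \<le> ((1 - c) \<cdot>\<^sub>v v1) $ i"
        using v1(1) \<Psi>(1) i by (simp del: index_mult_mat_vec)
    qed (use \<Psi> v1 v2 in auto)
    finally show ?thesis .
  qed
  have "rho (G * H) \<le> 1 - c" by (rule rho_le_if_subinvariant[OF GH GH0 n v1 GHv])
  moreover have "Z_splitting (1\<^sub>m n - G * H) 1 (G * H)"
    using GH GH0 G H by (simp add: Z_splitting_def) (auto intro!: eq_matI)
  ultimately show "nonsingular_M_matrix (1\<^sub>m n - G * H)"
    using c(1) unfolding nonsingular_M_matrix_def by (intro exI[of _ 1] exI[of _ "G * H"]) auto
  have Z: "(1\<^sub>m n - G * H) $$ (i,j) \<le> 0" if "i < n" "j < n" "i \<noteq> j" for i j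
    using nonneg_matD[OF GH0 that(1,2)] that G H by (simp del: index_mult_mat(1))
  have pos: "0 < ((1\<^sub>m n - G * H) *\<^sub>v v1) $ i" if i: "i < n" for i
  proof -
    have "((1\<^sub>m n - G * H) *\<^sub>v v1) = 1\<^sub>m n *\<^sub>v v1 - (G * H) *\<^sub>v v1"
      by (rule minus_mult_distrib_mat_vec[OF one_carrier_mat GH v1(1)])
    then have "((1\<^sub>m n - G * H) *\<^sub>v v1) $ i = v1 $ i - ((G * H) *\<^sub>v v1) $ i"
      using v1(1) G H i by (simp del: index_mult_mat_vec)
    moreover have "((G * H) *\<^sub>v v1) $ i \<le> (1 - c) * v1 $ i"
      using vec_leD[OF GHv _ i] G H v1(1) i by (simp del: index_mult_mat_vec)
    moreover have "0 < c * v1 $ i" using c v1(2)[OF i] by simp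
    ultimately show ?thesis by (simp add: algebra_simps)
  qed
  have car: "1\<^sub>m n - G * H \<in> carrier_mat n n" using GH by (rule minus_carrier_mat)
  note inv = mat_inv_Z_mat[OF car Z v1 pos]
  show "invertible_mat (1\<^sub>m n - G * H)" "mat_inv (1\<^sub>m n - G * H) * (1\<^sub>m n - G * H) = 1\<^sub>m n"
    "nonneg_posdiag n (mat_inv (1\<^sub>m n - G * H))"
    by (simp_all add: inv nonneg_posdiag_def)
qed

lemma doubling_state_step:
  assumes st: "doubling_state n m \<Phi> \<Psi> T U E F G H"
    and \<Phi>: "\<Phi> \<in> carrier_mat m n" and \<Psi>: "\<Psi> \<in> carrier_mat n m"
    and V: "nonneg_posdiag n V" "V * (1\<^sub>m n - G * H) = 1\<^sub>m n"
    and W: "nonneg_posdiag m W" "W * (1\<^sub>m m - H * G) = 1\<^sub>m m"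
  shows "doubling_state n m \<Phi> \<Psi> (T * T) (U * U)
      (E * V * E) (F * W * F) (G + E * V * G * F) (H + F * W * H * E)"
    and "G \<le> G + E * V * G * F" and "H \<le> H + F * W * H * E"
proof -
  have pd: "nonneg_posdiag n E" "nonneg_posdiag m F" "nonneg_posdiag n T" "nonneg_posdiag m U"
    and G: "G \<in> carrier_mat n m" "0\<^sub>m n m \<le> G" and H: "H \<in> carrier_mat m n" "0\<^sub>m m n \<le> H"
    and eqs: "E = (1\<^sub>m n - G * \<Phi>) * T" "\<Phi> - H = F * \<Phi> * T"
      "F = (1\<^sub>m m - H * \<Psi>) * U" "\<Psi> - G = E * \<Psi> * U"
    using st unfolding doubling_state_def by blast+
  note c = pd[THEN nonneg_posdiag_carrier] V(1)[THEN nonneg_posdiag_carrier]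
    W(1)[THEN nonneg_posdiag_carrier]
  note nn = pd[THEN nonneg_posdiag_nonneg]
  note EV = nonneg_posdiag_mult[OF pd(1) V(1)] and FW = nonneg_posdiag_mult[OF pd(2) W(1)]
  have EVG: "E * V * G \<in> carrier_mat n m" "0\<^sub>m n m \<le> E * V * G"
    using EV G mult_mat_nonneg[OF nonneg_posdiag_carrier[OF EV] nonneg_posdiag_nonneg[OF EV] G]
    by (auto simp: nonneg_posdiag_def)
  have FWH: "F * W * H \<in> carrier_mat m n" "0\<^sub>m m n \<le> F * W * H"
    using FW H mult_mat_nonneg[OF nonneg_posdiag_carrier[OF FW] nonneg_posdiag_nonneg[OF FW] H]
    by (auto simp: nonneg_posdiag_def)
  have dG: "E * V * G * F \<in> carrier_mat n m" "0\<^sub>m n m \<le> E * V * G * F"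
    using EVG(1) c(2) mult_mat_nonneg[OF EVG c(2) nn(2)] by auto
  have dH: "F * W * H * E \<in> carrier_mat m n" "0\<^sub>m m n \<le> F * W * H * E"
    using FWH(1) c(1) mult_mat_nonneg[OF FWH c(1) nn(1)] by auto
  show "G \<le> G + E * V * G * F"
    by (rule mat_le_add_nonneg[OF G(1) dG])
  show "H \<le> H + F * W * H * E"
    by (rule mat_le_add_nonneg[OF H(1) dH])
  note id1 = doubling_step_identities[OF c(1,2) G(1) H(1) \<Phi> c(3,5,6) eqs(1,2) V(2) W(2)]
  note id2 = doubling_step_identities[OF c(2,1) H(1) G(1) \<Psi> c(4,6,5) eqs(3,4) W(2) V(2)]
  show "doubling_state n m \<Phi> \<Psi> (T * T) (U * U)
      (E * V * E) (F * W * F) (G + E * V * G * F) (H + F * W * H * E)"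
    unfolding doubling_state_def
    by (intro conjI nonneg_posdiag_mult EV FW pd add_mat_nonneg G H dG dH add_carrier_mat id1 id2)
qed

section \<open>Root rates of convergence\<close>

text \<open>Up to a constant, every norm is dominated by the maximum of the moduli of the entries, by expansion
  in matrix units.\<close>

lemma norm_on_mats_entry_bound:
  assumes \<nu>: "norm_on_mats p q \<nu>"
  obtains c where "0 < c"
    "\<And>X b. X \<in> carrier_mat p q \<Longrightarrow> (\<And>i j. i < p \<Longrightarrow> j < q \<Longrightarrow> \<bar>X $$ (i,j)\<bar> \<le> b) \<Longrightarrow> 0 \<le> b \<Longrightarrow>
      \<nu> X \<le> c * b"
proof -
  \<comment> \<open>\<open>e z\<close> is the matrix unit at position \<open>z\<close>.\<close>
  define e :: "nat \<times> nat \<Rightarrow> real mat" where "e z = mat p q (\<lambda>x. if x = z then 1 else 0)" for z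
  define c where "c = 1 + (\<Sum>z\<in>{..<p}\<times>{..<q}. \<nu> (e z))"
  have ec: "e z \<in> carrier_mat p q" for z by (simp add: e_def)
  have e0: "0 \<le> \<nu> (e z)" for z using \<nu> ec unfolding norm_on_mats_def by blast
  have add: "\<nu> (X + Y) \<le> \<nu> X + \<nu> Y" if "X \<in> carrier_mat p q" "Y \<in> carrier_mat p q" for X Y
    using \<nu> that unfolding norm_on_mats_def by blast
  have smult: "\<nu> (a \<cdot>\<^sub>m X) = \<bar>a\<bar> * \<nu> X" if "X \<in> carrier_mat p q" for a X
    using \<nu> that unfolding norm_on_mats_def by blast
  have "\<nu> X \<le> c * b" if X: "X \<in> carrier_mat p q" "\<And>i j. i < p \<Longrightarrow> j < q \<Longrightarrow> \<bar>X $$ (i,j)\<bar> \<le> b"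
    and b: "0 \<le> b" for X b
  proof -
    define X' where "X' S = mat p q (\<lambda>x. if x \<in> S then X $$ x else 0)" for S
    have "\<nu> (X' S) \<le> (\<Sum>z\<in>S. b * \<nu> (e z))" if "finite S" "S \<subseteq> {..<p}\<times>{..<q}" for S
      using that
    proof (induction S)
      case empty
      have "X' {} = 0\<^sub>m p q" by (auto simp: X'_def intro!: eq_matI)
      moreover have "\<nu> (0\<^sub>m p q) = 0"
        using \<nu> zero_carrier_mat[of p q] unfolding norm_on_mats_def by blast
      ultimately show ?case by simp
    next
      case (insert z S)
      have "X' (insert z S) = X $$ z \<cdot>\<^sub>m e z + X' S"
        using insert.hyps by (auto simp: X'_def e_def intro!: eq_matI)
      moreover have "X' S \<in> carrier_mat p q" by (simp add: X'_def)
      ultimately have "\<nu> (X' (insert z S)) \<le> \<nu> (X $$ z \<cdot>\<^sub>m e z) + \<nu> (X' S)"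
        using add ec by simp
      also have "\<nu> (X $$ z \<cdot>\<^sub>m e z) = \<bar>X $$ z\<bar> * \<nu> (e z)"
        using smult ec by simp
      also have "\<dots> \<le> b * \<nu> (e z)"
        using insert.prems X(2) e0 by (intro mult_right_mono) auto
      finally show ?case using insert by simp
    qed
    from this[of "{..<p}\<times>{..<q}"] have "\<nu> (X' ({..<p}\<times>{..<q})) \<le> (\<Sum>z\<in>{..<p}\<times>{..<q}. b * \<nu> (e z))"
      by simp
    moreover have "X' ({..<p}\<times>{..<q}) = X"
      using X(1) by (auto simp: X'_def intro!: eq_matI)
    ultimately have "\<nu> X \<le> (\<Sum>z\<in>{..<p}\<times>{..<q}. \<nu> (e z)) * b"
      by (simp add: sum_distrib_left[symmetric] mult.commute)
    also have "\<dots> \<le> c * b" using b by (intro mult_right_mono) (auto simp: c_def)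
    finally show ?thesis .
  qed
  moreover have "0 < c" using e0 by (simp add: c_def add_pos_nonneg sum_nonneg)
  ultimately show thesis using that by blast
qed

lemma limsup_root_le:
  fixes x :: "nat \<Rightarrow> real"
  assumes s: "0 < s" and c: "0 < c"
    and x: "\<And>k. 1 \<le> k \<Longrightarrow> x k \<le> c * s ^ (2 ^ k)"
  shows "limsup (\<lambda>k. ereal (root (2 ^ k) (x k))) \<le> ereal s"
proof -
  have "(\<lambda>k. root (2 ^ k) c) \<longlonglongrightarrow> 1"
  proof -
    have "filterlim (\<lambda>k. 2 ^ k :: nat) at_top sequentially"
      by (rule filterlim_subseq) (simp add: strict_mono_def)
    from filterlim_compose[OF LIMSEQ_root_const[OF c] this] show ?thesis .
  qed
  then have "(\<lambda>k. ereal (root (2 ^ k) c * s)) \<longlonglongrightarrow> ereal (1 * s)"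
    by (intro tendsto_intros)
  then have lim: "limsup (\<lambda>k. ereal (root (2 ^ k) c * s)) = ereal s"
    by (simp add: lim_imp_Limsup)
  have "limsup (\<lambda>k. ereal (root (2 ^ k) (x k))) \<le> limsup (\<lambda>k. ereal (root (2 ^ k) c * s))"
  proof (rule Limsup_mono)
    show "\<forall>\<^sub>F k in sequentially. ereal (root (2 ^ k) (x k)) \<le> ereal (root (2 ^ k) c * s)"
      using eventually_ge_at_top[of 1]
    proof eventually_elim
      case (elim k)
      have "root (2 ^ k) (x k) \<le> root (2 ^ k) (c * s ^ (2 ^ k))"
        using x[OF elim] by simp
      also have "\<dots> = root (2 ^ k) c * s"
        using s by (simp add: real_root_mult real_root_power_cancel)
      finally show ?case by simp
    qed
  qed
  with lim show ?thesis by simp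
qed

lemma limsup_root_norm_le_rho_mult_rho:
  assumes P: "P \<in> carrier_mat m m" and Q: "Q \<in> carrier_mat n n" and \<Phi>: "\<Phi> \<in> carrier_mat m n"
    and pos: "0 < m" "0 < n"
    and \<nu>: "norm_on_mats m n \<nu>"
    and X: "\<And>k. X k \<in> carrier_mat m n"
    and le: "\<And>k i j. 1 \<le> k \<Longrightarrow> i < m \<Longrightarrow> j < n \<Longrightarrow>
      \<bar>X k $$ (i,j)\<bar> \<le> (P ^\<^sub>m (2 ^ k) * \<Phi> * Q ^\<^sub>m (2 ^ k)) $$ (i,j)"
  shows "limsup (\<lambda>k. ereal (root (2 ^ k) (\<nu> (X k)))) \<le> ereal (rho P * rho Q)"
proof -
  have rP: "0 \<le> rho P" and rQ: "0 \<le> rho Q" using rho_nonneg P Q pos by auto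
  obtain d where d: "0 < d"
    "\<And>X b. X \<in> carrier_mat m n \<Longrightarrow> (\<And>i j. i < m \<Longrightarrow> j < n \<Longrightarrow> \<bar>X $$ (i,j)\<bar> \<le> b) \<Longrightarrow> 0 \<le> b \<Longrightarrow>
      \<nu> X \<le> d * b"
    using norm_on_mats_entry_bound[OF \<nu>] by blast
  have main: "limsup (\<lambda>k. ereal (root (2 ^ k) (\<nu> (X k)))) \<le> ereal ((rho P + \<epsilon>) * (rho Q + \<epsilon>))"
    if \<epsilon>: "0 < \<epsilon>" for \<epsilon>
  proof -
    \<comment> \<open>The slack \<open>\<epsilon>\<close> also keeps both bases positive when a spectral radius vanishes.\<close>
    let ?p = "rho P + \<epsilon>" and ?q = "rho Q + \<epsilon>"
    obtain c1 where c1: "0 < c1"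
      "\<And>l i j. i < m \<Longrightarrow> j < m \<Longrightarrow> \<bar>(P ^\<^sub>m l) $$ (i,j)\<bar> \<le> c1 * ?p ^ l"
      using pow_mat_entry_bound[OF P pos(1), of ?p] \<epsilon> by auto
    obtain c2 where c2: "0 < c2"
      "\<And>l i j. i < n \<Longrightarrow> j < n \<Longrightarrow> \<bar>(Q ^\<^sub>m l) $$ (i,j)\<bar> \<le> c2 * ?q ^ l"
      using pow_mat_entry_bound[OF Q pos(2), of ?q] \<epsilon> by auto
    define w where "w = 1 + (\<Sum>b<n. \<Sum>a<m. \<bar>\<Phi> $$ (a,b)\<bar>)"
    have w: "0 < w" by (simp add: w_def add_pos_nonneg sum_nonneg)
    have entry: "\<bar>X k $$ (i,j)\<bar> \<le> c1 * c2 * w * (?p * ?q) ^ (2 ^ k)"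
      if k: "1 \<le> k" and ij: "i < m" "j < n" for k i j
    proof -
      let ?N = "2 ^ k :: nat"
      have PN: "P ^\<^sub>m ?N \<in> carrier_mat m m" and QN: "Q ^\<^sub>m ?N \<in> carrier_mat n n"
        using P Q by simp_all
      have p0: "0 \<le> c1 * ?p ^ ?N" and q0: "0 \<le> c2 * ?q ^ ?N"
        using c1 c2 rP rQ \<epsilon> by auto
      have "(P ^\<^sub>m ?N * \<Phi> * Q ^\<^sub>m ?N) $$ (i,j) =
          (\<Sum>b<n. (P ^\<^sub>m ?N * \<Phi>) $$ (i,b) * (Q ^\<^sub>m ?N) $$ (b,j))"
        by (rule mult_mat_entry[OF mult_carrier_mat[OF PN \<Phi>] QN ij])
      also have "\<dots> = (\<Sum>b<n. (\<Sum>a<m. (P ^\<^sub>m ?N) $$ (i,a) * \<Phi> $$ (a,b)) * (Q ^\<^sub>m ?N) $$ (b,j))"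
        by (intro sum.cong refl) (subst mult_mat_entry[OF PN \<Phi> ij(1)]; simp)
      also have "\<dots> = (\<Sum>b<n. \<Sum>a<m. (P ^\<^sub>m ?N) $$ (i,a) * \<Phi> $$ (a,b) * (Q ^\<^sub>m ?N) $$ (b,j))"
        by (simp add: sum_distrib_right)
      also have "\<dots> \<le> (\<Sum>b<n. \<Sum>a<m. (c1 * ?p ^ ?N) * \<bar>\<Phi> $$ (a,b)\<bar> * (c2 * ?q ^ ?N))"
      proof (intro sum_mono)
        fix a b assume ab: "b \<in> {..<n}" "a \<in> {..<m}"
        have "(P ^\<^sub>m ?N) $$ (i,a) * \<Phi> $$ (a,b) * (Q ^\<^sub>m ?N) $$ (b,j)
            \<le> \<bar>(P ^\<^sub>m ?N) $$ (i,a)\<bar> * \<bar>\<Phi> $$ (a,b)\<bar> * \<bar>(Q ^\<^sub>m ?N) $$ (b,j)\<bar>"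
          by (simp only: abs_mult[symmetric] abs_ge_self)
        also have "\<dots> \<le> (c1 * ?p ^ ?N) * \<bar>\<Phi> $$ (a,b)\<bar> * (c2 * ?q ^ ?N)"
          using c1 c2 rP rQ \<epsilon> ij ab by (intro mult_mono mult_nonneg_nonneg) auto
        finally show "(P ^\<^sub>m ?N) $$ (i,a) * \<Phi> $$ (a,b) * (Q ^\<^sub>m ?N) $$ (b,j)
            \<le> (c1 * ?p ^ ?N) * \<bar>\<Phi> $$ (a,b)\<bar> * (c2 * ?q ^ ?N)" .
      qed
      also have "\<dots> = c1 * c2 * (?p * ?q) ^ ?N * (\<Sum>b<n. \<Sum>a<m. \<bar>\<Phi> $$ (a,b)\<bar>)"
        unfolding sum_distrib_left power_mult_distrib by (intro sum.cong refl) (simp only: mult_ac)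
      also have "\<dots> \<le> c1 * c2 * (?p * ?q) ^ ?N * w"
        using c1(1) c2(1) rP rQ \<epsilon> by (intro mult_left_mono) (auto simp: w_def)
      finally show ?thesis using le[OF k ij] by (simp add: mult_ac)
    qed
    show ?thesis
    proof (rule limsup_root_le)
      show "0 < ?p * ?q" using rP rQ \<epsilon> by simp
      show "0 < d * (c1 * c2 * w)" using d(1) c1(1) c2(1) w by simp
      fix k :: nat assume k: "1 \<le> k"
      have "\<nu> (X k) \<le> d * (c1 * c2 * w * (?p * ?q) ^ (2 ^ k))"
        by (rule d(2)[OF X entry[OF k]]) (use c1 c2 w rP rQ \<epsilon> in auto)
      then show "\<nu> (X k) \<le> d * (c1 * c2 * w) * (?p * ?q) ^ (2 ^ k)" by (simp add: mult_ac)
    qed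
  qed
  have "((\<lambda>\<epsilon>. (rho P + \<epsilon>) * (rho Q + \<epsilon>)) \<longlongrightarrow> (rho P + 0) * (rho Q + 0)) (at_right 0)"
    by (intro tendsto_intros)
  then have "((\<lambda>\<epsilon>. ereal ((rho P + \<epsilon>) * (rho Q + \<epsilon>))) \<longlongrightarrow> ereal (rho P * rho Q)) (at_right 0)"
    by simp
  then show ?thesis
    by (rule tendsto_lowerbound) (use main in \<open>auto simp: eventually_at_filter\<close>)
qed

section \<open>Regular M-matrices in block form and the initial matrices\<close>

lemma regular_block_M_matrix:
  fixes A B C D :: "real mat"
  assumes car: "A \<in> carrier_mat m m" "B \<in> carrier_mat m n" "C \<in> carrier_mat n m" "D \<in> carrier_mat n n"
    and reg: "regular_M_matrix (four_block_mat D (- C) (- B) A)"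
  obtains v1 v2 where "0\<^sub>m m n \<le> B" "0\<^sub>m n m \<le> C"
    "\<And>i j. i < m \<Longrightarrow> j < m \<Longrightarrow> i \<noteq> j \<Longrightarrow> A $$ (i,j) \<le> 0"
    "\<And>i j. i < n \<Longrightarrow> j < n \<Longrightarrow> i \<noteq> j \<Longrightarrow> D $$ (i,j) \<le> 0"
    "v1 \<in> carrier_vec n" "\<And>j. j < n \<Longrightarrow> 0 < v1 $ j"
    "v2 \<in> carrier_vec m" "\<And>i. i < m \<Longrightarrow> 0 < v2 $ i"
    "C *\<^sub>v v2 \<le> D *\<^sub>v v1" "B *\<^sub>v v1 \<le> A *\<^sub>v v2"
proof -
  let ?K = "four_block_mat D (- C) (- B) A"
  have "Z_matrix ?K"
    using reg by (auto simp: regular_M_matrix_def M_matrix_def Z_matrix_iff_splitting)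
  then have Z: "?K $$ (i,j) \<le> 0" if "i < n + m" "j < n + m" "i \<noteq> j" for i j
    using that car by (auto simp: Z_matrix_def)
  obtain v where v: "v \<in> carrier_vec (n + m)" "\<And>i. i < n + m \<Longrightarrow> 0 < v $ i"
      "0\<^sub>v (n + m) \<le> ?K *\<^sub>v v"
    using reg car by (auto simp: regular_M_matrix_def)
  define v1 where "v1 = vec_first v n"
  define v2 where "v2 = vec_last v m"
  have vv: "v1 @\<^sub>v v2 = v" using v(1) by (simp add: v1_def v2_def)
  have vc: "v1 \<in> carrier_vec n" "v2 \<in> carrier_vec m" by (simp_all add: v1_def v2_def)
  have v1: "0 < v1 $ j" if "j < n" for j
    using v(2)[of j] that vc by (simp add: vv[symmetric])
  have v2: "0 < v2 $ i" if "i < m" for i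
    using v(2)[of "n + i"] that vc by (simp add: vv[symmetric])
  have Kv: "?K *\<^sub>v v = (D *\<^sub>v v1 + - C *\<^sub>v v2) @\<^sub>v (- B *\<^sub>v v1 + A *\<^sub>v v2)"
    unfolding vv[symmetric] by (rule four_block_mat_mult_vec) (use car vc in auto)
  have um: "- C *\<^sub>v v2 = - (C *\<^sub>v v2)" "- B *\<^sub>v v1 = - (B *\<^sub>v v1)" using car vc by auto
  show thesis
  proof (rule that[of v1 v2])
    show "0\<^sub>m m n \<le> B"
    proof (rule mat_leI[OF _ car(2)])
      fix i j assume "i < m" "j < n"
      then show "0\<^sub>m m n $$ (i,j) \<le> B $$ (i,j)" using Z[of "n + i" j] car by simp
    qed simp
    show "0\<^sub>m n m \<le> C"
    proof (rule mat_leI[OF _ car(3)])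
      fix i j assume "i < n" "j < m"
      then show "0\<^sub>m n m $$ (i,j) \<le> C $$ (i,j)" using Z[of i "n + j"] car by simp
    qed simp
    show "A $$ (i,j) \<le> 0" if "i < m" "j < m" "i \<noteq> j" for i j
      using Z[of "n + i" "n + j"] that car by simp
    show "D $$ (i,j) \<le> 0" if "i < n" "j < n" "i \<noteq> j" for i j
      using Z[of i j] that car by simp
    show "C *\<^sub>v v2 \<le> D *\<^sub>v v1"
    proof (rule vec_leI)
      fix i assume "i < n"
      then show "(C *\<^sub>v v2) $ i \<le> (D *\<^sub>v v1) $ i"
        using nonneg_vecD[OF v(3), of i] car vc by (simp add: Kv um del: index_mult_mat_vec)
    qed (use car vc in auto)
    show "B *\<^sub>v v1 \<le> A *\<^sub>v v2"
    proof (rule vec_leI)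
      fix i assume "i < m"
      then show "(B *\<^sub>v v1) $ i \<le> (A *\<^sub>v v2) $ i"
        using nonneg_vecD[OF v(3), of "n + i"] car vc by (simp add: Kv um del: index_mult_mat_vec)
    qed (use car vc in auto)
  qed (use vc v1 v2 in auto)
qed

text \<open>The matrix \<open>R = D - C * \<Phi>\<close> is a Z-matrix with \<open>R *\<^sub>v v1 \<ge> D *\<^sub>v v1 - C *\<^sub>v v2 \<ge> 0\<close>, and its
  diagonal stays below \<open>\<beta>\<close>.\<close>

lemma closed_loop_shift:
  fixes C D R \<Phi> :: "real mat"
  assumes car: "C \<in> carrier_mat n m" "D \<in> carrier_mat n n"
    and Z: "\<And>i j. i < n \<Longrightarrow> j < n \<Longrightarrow> i \<noteq> j \<Longrightarrow> D $$ (i,j) \<le> 0"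
    and diag: "\<And>i. i < n \<Longrightarrow> D $$ (i,i) < \<beta>" and \<alpha>: "0 < \<alpha>"
    and C: "0\<^sub>m n m \<le> C" and \<Phi>: "\<Phi> \<in> carrier_mat m n" "0\<^sub>m m n \<le> \<Phi>"
    and v1: "v1 \<in> carrier_vec n" "\<And>j. j < n \<Longrightarrow> 0 < v1 $ j"
    and v2: "v2 \<in> carrier_vec m"
    and \<Phi>v: "\<Phi> *\<^sub>v v1 \<le> v2" and Cv: "C *\<^sub>v v2 \<le> D *\<^sub>v v1"
    and R: "R = D - C * \<Phi>"
  shows "invertible_mat (R + \<alpha> \<cdot>\<^sub>m 1\<^sub>m n)"
    and "nonneg_posdiag n (- (mat_inv (R + \<alpha> \<cdot>\<^sub>m 1\<^sub>m n) * (R - \<beta> \<cdot>\<^sub>m 1\<^sub>m n)))"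
    and "(R + \<alpha> \<cdot>\<^sub>m 1\<^sub>m n) * (mat_inv (R + \<alpha> \<cdot>\<^sub>m 1\<^sub>m n) * (R - \<beta> \<cdot>\<^sub>m 1\<^sub>m n)) = R - \<beta> \<cdot>\<^sub>m 1\<^sub>m n"
proof -
  have C\<Phi>: "C * \<Phi> \<in> carrier_mat n n" "0\<^sub>m n n \<le> C * \<Phi>"
    using mult_mat_nonneg[OF car(1) C \<Phi>] car \<Phi> by auto
  have Rc: "R \<in> carrier_mat n n" unfolding R by (rule minus_carrier_mat[OF C\<Phi>(1)])
  have Re: "R $$ (i,j) = D $$ (i,j) - (C * \<Phi>) $$ (i,j)" if "i < n" "j < n" for i j
    using that car \<Phi> unfolding R by (simp del: index_mult_mat(1))
  have off: "R $$ (i,j) \<le> 0" if "i < n" "j < n" "i \<noteq> j" for i j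
    using Re[OF that(1,2)] Z[OF that] nonneg_matD[OF C\<Phi>(2) that(1,2)] by simp
  have dia: "R $$ (i,i) < \<beta>" if "i < n" for i
    using Re[OF that that] diag[OF that] nonneg_matD[OF C\<Phi>(2) that that] by simp
  have v0: "0\<^sub>v n \<le> v1" using v1 by (auto simp: less_eq_vec_def less_imp_le)
  have pos: "0 < ((R + \<alpha> \<cdot>\<^sub>m 1\<^sub>m n) *\<^sub>v v1) $ i" if i: "i < n" for i
  proof -
    have "(R + \<alpha> \<cdot>\<^sub>m 1\<^sub>m n) *\<^sub>v v1 = R *\<^sub>v v1 + (\<alpha> \<cdot>\<^sub>m 1\<^sub>m n) *\<^sub>v v1"
      by (rule add_mult_distrib_mat_vec[OF Rc _ v1(1)]) simp
    also have "(\<alpha> \<cdot>\<^sub>m 1\<^sub>m n) *\<^sub>v v1 = \<alpha> \<cdot>\<^sub>v v1" by (rule scalar_mat_mult_vec[OF v1(1)])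
    also have "R *\<^sub>v v1 = D *\<^sub>v v1 - (C * \<Phi>) *\<^sub>v v1"
      unfolding R by (rule minus_mult_distrib_mat_vec[OF car(2) C\<Phi>(1) v1(1)])
    also have "(C * \<Phi>) *\<^sub>v v1 = C *\<^sub>v (\<Phi> *\<^sub>v v1)"
      by (rule assoc_mult_mat_vec[OF car(1) \<Phi>(1) v1(1)])
    finally have e: "((R + \<alpha> \<cdot>\<^sub>m 1\<^sub>m n) *\<^sub>v v1) $ i =
        (D *\<^sub>v v1) $ i - (C *\<^sub>v (\<Phi> *\<^sub>v v1)) $ i + \<alpha> * v1 $ i"
      using i car v1(1) by (simp del: index_mult_mat_vec)
    have "C *\<^sub>v (\<Phi> *\<^sub>v v1) \<le> C *\<^sub>v v2"
      by (rule mult_mat_vec_mono[OF car(1) C order_refl _ mult_mat_nonneg_vec[OF \<Phi> v1(1) v0] \<Phi>v])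
        (use \<Phi> v1 in simp)
    then have "C *\<^sub>v (\<Phi> *\<^sub>v v1) \<le> D *\<^sub>v v1" using Cv by (rule order_trans)
    then have "(C *\<^sub>v (\<Phi> *\<^sub>v v1)) $ i \<le> (D *\<^sub>v v1) $ i"
      by (rule vec_leD[OF _ mult_mat_vec_carrier[OF car(1) mult_mat_vec_carrier[OF \<Phi>(1) v1(1)]] i])
    moreover have "0 < \<alpha> * v1 $ i" using \<alpha> v1(2)[OF i] by simp
    ultimately show ?thesis unfolding e by linarith
  qed
  have Lc: "R + \<alpha> \<cdot>\<^sub>m 1\<^sub>m n \<in> carrier_mat n n" by simp
  have off': "(R + \<alpha> \<cdot>\<^sub>m 1\<^sub>m n) $$ (i,j) \<le> 0" if "i < n" "j < n" "i \<noteq> j" for i j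
    using off[OF that] that Rc by simp
  have inv: "mat_inv (R + \<alpha> \<cdot>\<^sub>m 1\<^sub>m n) \<in> carrier_mat n n" "(R + \<alpha> \<cdot>\<^sub>m 1\<^sub>m n) * mat_inv (R + \<alpha> \<cdot>\<^sub>m 1\<^sub>m n) = 1\<^sub>m n"
      "mat_inv (R + \<alpha> \<cdot>\<^sub>m 1\<^sub>m n) * (R + \<alpha> \<cdot>\<^sub>m 1\<^sub>m n) = 1\<^sub>m n" "invertible_mat (R + \<alpha> \<cdot>\<^sub>m 1\<^sub>m n)"
      "0\<^sub>m n n \<le> mat_inv (R + \<alpha> \<cdot>\<^sub>m 1\<^sub>m n)" "\<And>i. i < n \<Longrightarrow> 0 < mat_inv (R + \<alpha> \<cdot>\<^sub>m 1\<^sub>m n) $$ (i,i)"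
    by (simp_all add: mat_inv_Z_mat[OF Lc off' v1 pos])
  show "invertible_mat (R + \<alpha> \<cdot>\<^sub>m 1\<^sub>m n)" by (rule inv(4))
  have pd: "nonneg_posdiag n (mat_inv (R + \<alpha> \<cdot>\<^sub>m 1\<^sub>m n))" using inv by (simp add: nonneg_posdiag_def)
  have rhs: "R - \<beta> \<cdot>\<^sub>m 1\<^sub>m n \<in> carrier_mat n n" by (simp add: minus_carrier_mat)
  have pd': "nonneg_posdiag n (- (R - \<beta> \<cdot>\<^sub>m 1\<^sub>m n))"
    unfolding nonneg_posdiag_def
  proof (intro conjI allI impI)
    show "0\<^sub>m n n \<le> - (R - \<beta> \<cdot>\<^sub>m 1\<^sub>m n)"
    proof (rule mat_leI[of _ n n])
      fix i j assume ij: "i < n" "j < n"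
      then show "0\<^sub>m n n $$ (i,j) \<le> (- (R - \<beta> \<cdot>\<^sub>m 1\<^sub>m n)) $$ (i,j)"
        using off[OF ij] dia[OF ij(1)] Rc by (cases "i = j") auto
    qed (use rhs in auto)
  qed (use rhs dia Rc in auto)
  have "mat_inv (R + \<alpha> \<cdot>\<^sub>m 1\<^sub>m n) * (- (R - \<beta> \<cdot>\<^sub>m 1\<^sub>m n)) =
      - (mat_inv (R + \<alpha> \<cdot>\<^sub>m 1\<^sub>m n) * (R - \<beta> \<cdot>\<^sub>m 1\<^sub>m n))"
    using inv(1) rhs by (intro uminus_mult_right_mat) auto
  then show "nonneg_posdiag n (- (mat_inv (R + \<alpha> \<cdot>\<^sub>m 1\<^sub>m n) * (R - \<beta> \<cdot>\<^sub>m 1\<^sub>m n)))"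
    using nonneg_posdiag_mult[OF pd pd'] by simp
  show "(R + \<alpha> \<cdot>\<^sub>m 1\<^sub>m n) * (mat_inv (R + \<alpha> \<cdot>\<^sub>m 1\<^sub>m n) * (R - \<beta> \<cdot>\<^sub>m 1\<^sub>m n)) = R - \<beta> \<cdot>\<^sub>m 1\<^sub>m n"
    using assoc_mult_mat[OF Lc inv(1) rhs] left_mult_one_mat[OF rhs] inv(2) by (simp only:)
qed

text \<open>The initial matrices are the blocks of \<open>P = mat_inv L * N\<close>, where \<open>L\<close> has a nonnegative inverse
  with positive diagonal and \<open>- N\<close> is nonnegative with positive diagonal.  The last claim is the
  injectivity of \<open>L\<close> in block form.\<close>

lemma adda_init_properties:
  fixes A B C D E F G H :: "real mat"
  assumes car: "A \<in> carrier_mat m m" "B \<in> carrier_mat m n" "C \<in> carrier_mat n m" "D \<in> carrier_mat n n"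
    and nonneg: "0\<^sub>m m n \<le> B" "0\<^sub>m n m \<le> C"
    and ZA: "\<And>i j. i < m \<Longrightarrow> j < m \<Longrightarrow> i \<noteq> j \<Longrightarrow> A $$ (i,j) \<le> 0"
    and ZD: "\<And>i j. i < n \<Longrightarrow> j < n \<Longrightarrow> i \<noteq> j \<Longrightarrow> D $$ (i,j) \<le> 0"
    and \<alpha>: "0 < \<alpha>" "\<And>i. i < m \<Longrightarrow> A $$ (i,i) < \<alpha>" and \<beta>: "0 < \<beta>" "\<And>i. i < n \<Longrightarrow> D $$ (i,i) < \<beta>"
    and v1: "v1 \<in> carrier_vec n" "\<And>j. j < n \<Longrightarrow> 0 < v1 $ j"
    and v2: "v2 \<in> carrier_vec m" "\<And>i. i < m \<Longrightarrow> 0 < v2 $ i"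
    and super: "C *\<^sub>v v2 \<le> D *\<^sub>v v1" "B *\<^sub>v v1 \<le> A *\<^sub>v v2"
    and init: "adda_init A B C D \<alpha> \<beta> = (E, F, G, H)"
  shows "invertible_mat (adda_lhs A B C D \<alpha> \<beta>)"
    and "nonneg_posdiag n (- E)" "nonneg_posdiag m (- F)"
    and "G \<in> carrier_mat n m" "0\<^sub>m n m \<le> G" "H \<in> carrier_mat m n" "0\<^sub>m m n \<le> H"
    and "(D + \<alpha> \<cdot>\<^sub>m 1\<^sub>m n) * E + C * H = D - \<beta> \<cdot>\<^sub>m 1\<^sub>m n"
    and "(D + \<alpha> \<cdot>\<^sub>m 1\<^sub>m n) * G + C * F = C"
    and "B * E + (A + \<beta> \<cdot>\<^sub>m 1\<^sub>m m) * H = B"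
    and "B * G + (A + \<beta> \<cdot>\<^sub>m 1\<^sub>m m) * F = A - \<alpha> \<cdot>\<^sub>m 1\<^sub>m m"
    and "\<And>X Y q. X \<in> carrier_mat n q \<Longrightarrow> Y \<in> carrier_mat m q \<Longrightarrow>
      (D + \<alpha> \<cdot>\<^sub>m 1\<^sub>m n) * X = C * Y \<Longrightarrow> (A + \<beta> \<cdot>\<^sub>m 1\<^sub>m m) * Y = B * X \<Longrightarrow>
      X = 0\<^sub>m n q \<and> Y = 0\<^sub>m m q"
proof -
  define L where "L = adda_lhs A B C D \<alpha> \<beta>"
  define N where "N = adda_rhs A B C D \<alpha> \<beta>"
  let ?D = "D + \<alpha> \<cdot>\<^sub>m 1\<^sub>m n" and ?A = "A + \<beta> \<cdot>\<^sub>m 1\<^sub>m m"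
  let ?D' = "D - \<beta> \<cdot>\<^sub>m 1\<^sub>m n" and ?A' = "A - \<alpha> \<cdot>\<^sub>m 1\<^sub>m m"
  have L: "L = four_block_mat ?D (- C) (- B) ?A" using car by (simp add: L_def adda_lhs_def)
  have N: "N = four_block_mat ?D' (- C) (- B) ?A'" using car by (simp add: N_def adda_rhs_def)
  have bc: "?D \<in> carrier_mat n n" "?A \<in> carrier_mat m m" "- C \<in> carrier_mat n m" "- B \<in> carrier_mat m n"
      "?D' \<in> carrier_mat n n" "?A' \<in> carrier_mat m m"
    using car by (auto simp: minus_carrier_mat)
  have Lc: "L \<in> carrier_mat (n + m) (n + m)" and Nc: "N \<in> carrier_mat (n + m) (n + m)"
    using bc by (auto simp: L N)
  have Lz: "L $$ (i,j) \<le> 0" if "i < n + m" "j < n + m" "i \<noteq> j" for i j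
    using that car ZA[of "i - n" "j - n"] ZD[of i j] nonneg_matD[OF nonneg(1), of "i - n" j]
      nonneg_matD[OF nonneg(2), of i "j - n"]
    by (auto simp: L)
  define v where "v = v1 @\<^sub>v v2"
  have v: "v \<in> carrier_vec (n + m)" "\<And>i. i < n + m \<Longrightarrow> 0 < v $ i"
    using v1 v2 by (auto simp: v_def)
  have Lv: "L *\<^sub>v v = (?D *\<^sub>v v1 + - C *\<^sub>v v2) @\<^sub>v (- B *\<^sub>v v1 + ?A *\<^sub>v v2)"
    unfolding L v_def by (rule four_block_mat_mult_vec) (use bc v1 v2 in auto)
  have Dv: "?D *\<^sub>v v1 = D *\<^sub>v v1 + \<alpha> \<cdot>\<^sub>v v1"
    using car v1 by (simp add: add_mult_distrib_mat_vec[of _ n n] scalar_mat_mult_vec)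
  have Av: "?A *\<^sub>v v2 = A *\<^sub>v v2 + \<beta> \<cdot>\<^sub>v v2"
    using car v2 by (simp add: add_mult_distrib_mat_vec[of _ m m] scalar_mat_mult_vec)
  have Cv: "- C *\<^sub>v v2 = - (C *\<^sub>v v2)" and Bv: "- B *\<^sub>v v1 = - (B *\<^sub>v v1)"
    using car v1 v2 by auto
  have pos: "0 < (L *\<^sub>v v) $ i" if i: "i < n + m" for i
  proof (cases "i < n")
    case True
    have "(C *\<^sub>v v2) $ i \<le> (D *\<^sub>v v1) $ i"
      by (rule vec_leD[OF super(1) mult_mat_vec_carrier[OF car(3) v2(1)] True])
    moreover have "0 < \<alpha> * v1 $ i" using \<alpha> v1(2)[OF True] by simp
    ultimately show ?thesis
      using True i car v1 v2 by (simp add: Lv Dv Av Cv Bv del: index_mult_mat_vec)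
  next
    case False
    then have im: "i - n < m" using i by simp
    have "(B *\<^sub>v v1) $ (i - n) \<le> (A *\<^sub>v v2) $ (i - n)"
      by (rule vec_leD[OF super(2) mult_mat_vec_carrier[OF car(2) v1(1)] im])
    moreover have "0 < \<beta> * v2 $ (i - n)" using \<beta> v2(2)[OF im] by simp
    ultimately show ?thesis
      using False i car v1 v2 by (simp add: Lv Dv Av Cv Bv del: index_mult_mat_vec)
  qed
  have inv: "mat_inv L \<in> carrier_mat (n + m) (n + m)" "L * mat_inv L = 1\<^sub>m (n + m)"
      "mat_inv L * L = 1\<^sub>m (n + m)" "invertible_mat L"
      "0\<^sub>m (n + m) (n + m) \<le> mat_inv L" "\<And>i. i < (n + m) \<Longrightarrow> 0 < mat_inv L $$ (i,i)"
    by (simp_all add: mat_inv_Z_mat[OF Lc Lz v pos])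
  show "invertible_mat (adda_lhs A B C D \<alpha> \<beta>)" using inv(4) by (simp add: L_def)
  have pdL: "nonneg_posdiag (n + m) (mat_inv L)" using inv by (simp add: nonneg_posdiag_def)
  have pdN: "nonneg_posdiag (n + m) (- N)"
    unfolding nonneg_posdiag_def
  proof (intro conjI allI impI)
    show "0\<^sub>m (n + m) (n + m) \<le> - N"
    proof (rule mat_leI[of _ "n + m" "n + m"])
      fix i j assume ij: "i < n + m" "j < n + m"
      have "N $$ (i,j) \<le> 0"
        using ij car ZA[of "i - n" "j - n"] ZD[of i j] nonneg_matD[OF nonneg(1), of "i - n" j]
          nonneg_matD[OF nonneg(2), of i "j - n"] \<alpha>(2)[of "i - n"] \<beta>(2)[of i]
        by (cases "i = j") (auto simp: N less_imp_le)
      then show "0\<^sub>m (n + m) (n + m) $$ (i,j) \<le> (- N) $$ (i,j)" using ij Nc by simp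
    qed (use Nc in auto)
    fix i assume i: "i < n + m"
    have "N $$ (i,i) < 0" using i car \<alpha>(2)[of "i - n"] \<beta>(2)[of i] by (auto simp: N)
    then show "0 < (- N) $$ (i,i)" using i Nc by simp
  qed (use Nc in auto)
  define P where "P = mat_inv L * N"
  have Pc: "P \<in> carrier_mat (n + m) (n + m)" using inv(1) Nc by (simp add: P_def)
  have LP: "L * P = N"
    using assoc_mult_mat[OF Lc inv(1) Nc] left_mult_one_mat[OF Nc] inv(2) by (simp only: P_def)
  have "mat_inv L * (- N) = - P"
    unfolding P_def using inv(1) Nc by (intro uminus_mult_right_mat) auto
  with nonneg_posdiag_mult[OF pdL pdN] have pdP: "nonneg_posdiag (n + m) (- P)" by simp
  obtain P11 P12 P21 P22 where sp: "split_block P n n = (P11, P12, P21, P22)"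
    by (cases "split_block P n n") auto
  have EFGH: "E = P11" "F = P22" "G = - P12" "H = - P21"
    using init car sp by (auto simp: adda_init_def P_def L_def N_def)
  note spl = split_block[OF sp carrier_matD[OF Pc]]
  have Eij: "E $$ (i,j) = P $$ (i,j)" if "i < n" "j < n" for i j
    using that spl(1-4) by (simp add: EFGH spl(5))
  have Fij: "F $$ (i,j) = P $$ (n + i, n + j)" if "i < m" "j < m" for i j
    using that spl(1-4) by (simp add: EFGH spl(5))
  have Gij: "G $$ (i,j) = - P $$ (i, n + j)" if "i < n" "j < m" for i j
    using that spl(1-4) by (simp add: EFGH spl(5))
  have Hij: "H $$ (i,j) = - P $$ (n + i, j)" if "i < m" "j < n" for i j
    using that spl(1-4) by (simp add: EFGH spl(5))
  have Pneg: "P $$ (i,j) \<le> 0" if "i < n + m" "j < n + m" for i j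
    using nonneg_matD[OF nonneg_posdiag_nonneg[OF pdP] that] Pc that by simp
  have Pdiag: "P $$ (i,i) < 0" if "i < n + m" for i
    using pdP Pc that by (simp add: nonneg_posdiag_def)
  have ec: "E \<in> carrier_mat n n" "F \<in> carrier_mat m m" using spl by (auto simp: EFGH)
  show Gc: "G \<in> carrier_mat n m" and Hc: "H \<in> carrier_mat m n" using spl by (auto simp: EFGH)
  show "0\<^sub>m n m \<le> G" by (rule mat_leI[OF _ Gc]) (auto simp: Gij Pneg)
  show "0\<^sub>m m n \<le> H" by (rule mat_leI[OF _ Hc]) (auto simp: Hij Pneg)
  show "nonneg_posdiag n (- E)"
    unfolding nonneg_posdiag_def using ec
    by (intro conjI mat_leI[of _ n n]) (auto simp: Eij Pneg Pdiag)
  show "nonneg_posdiag m (- F)"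
    unfolding nonneg_posdiag_def using ec
    by (intro conjI mat_leI[of _ m m]) (auto simp: Fij Pneg Pdiag)
  have P: "P = four_block_mat E (- G) (- H) F" using spl by (simp add: EFGH)
  have "L * P = four_block_mat (?D * E + - C * - H) (?D * - G + - C * F)
      (- B * E + ?A * - H) (- B * - G + ?A * F)"
    unfolding L P by (rule mult_four_block_mat) (use bc ec Gc Hc in auto)
  with LP have eq: "four_block_mat (?D * E + - C * - H) (?D * - G + - C * F)
      (- B * E + ?A * - H) (- B * - G + ?A * F) = four_block_mat ?D' (- C) (- B) ?A'"
    by (simp only: N)
  note blocks = four_block_mat_inject[OF eq, of n n m m]
  have um: "- M * - M' = M * M'" "M * - M' = - (M * M')" "- M * M' = - (M * M')"
    if "dim_col M = dim_row M'" for M M' :: "real mat"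
    using that by auto
  have b: "?D * E + - C * - H = ?D'" "?D * - G + - C * F = - C"
      "- B * E + ?A * - H = - B" "- B * - G + ?A * F = ?A'"
    by (rule blocks; use bc ec Gc Hc car in \<open>auto intro!: add_carrier_mat mult_carrier_mat\<close>)+
  show "?D * E + C * H = ?D'" using b(1) car Hc by (simp add: um)
  show "B * G + ?A * F = ?A'" using b(4) car Gc by (simp add: um)
  have neg: "X + Y = Z"
    if "- X + - Y = - Z" "X \<in> carrier_mat p r" "Y \<in> carrier_mat p r" "Z \<in> carrier_mat p r"
    for X Y Z :: "real mat" and p r
  proof (rule eq_matI)
    fix i j assume "i < dim_row Z" "j < dim_col Z"
    then show "(X + Y) $$ (i,j) = Z $$ (i,j)"
      using mat_entry_cong[OF that(1), of i j] that(2-4) by simp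
  qed (use that in auto)
  show "?D * G + C * F = C"
  proof (rule neg)
    show "- (?D * G) + - (C * F) = - C" using b(2) car ec Gc by (simp add: um)
  qed (rule mult_carrier_mat[OF bc(1) Gc] mult_carrier_mat[OF car(3) ec(2)] car(3))+
  show "B * E + ?A * H = B"
  proof (rule neg)
    show "- (B * E) + - (?A * H) = - B" using b(3) car ec Hc by (simp add: um)
  qed (rule mult_carrier_mat[OF car(2) ec(1)] mult_carrier_mat[OF bc(2) Hc] car(2))+
  fix X Y :: "real mat" and q
  assume X: "X \<in> carrier_mat n q" and Y: "Y \<in> carrier_mat m q"
    and XY: "?D * X = C * Y" "?A * Y = B * X"
  \<comment> \<open>The zero blocks have no columns: \<open>M\<close> stacks \<open>X\<close> on top of \<open>Y\<close>.\<close>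
  define M where "M = four_block_mat X (0\<^sub>m n 0) Y (0\<^sub>m m 0)"
  have Mc: "M \<in> carrier_mat (n + m) (q + 0)" unfolding M_def using X by (intro four_block_carrier_mat) auto
  have z: "Z + - Z = 0\<^sub>m p r" "- Z + Z = 0\<^sub>m p r" if "Z \<in> carrier_mat p r" for Z :: "real mat" and p r
    using that by auto
  have "L * M = four_block_mat (?D * X + - C * Y) (?D * 0\<^sub>m n 0 + - C * 0\<^sub>m m 0)
      (- B * X + ?A * Y) (- B * 0\<^sub>m n 0 + ?A * 0\<^sub>m m 0)"
    unfolding L M_def
    by (rule mult_four_block_mat[OF bc(1,3,4,2) X zero_carrier_mat Y zero_carrier_mat])
  also have "?D * X + - C * Y = 0\<^sub>m n q"
    using car X Y z(1)[of "C * Y" n q] by (simp add: XY um)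
  also have "- B * X + ?A * Y = 0\<^sub>m m q"
    using car X Y z(2)[of "B * X" m q] by (simp add: XY um)
  finally have "L * M = 0\<^sub>m (n + m) (q + 0)"
    using bc by (auto intro!: eq_matI)
  then have "mat_inv L * (L * M) = mat_inv L * 0\<^sub>m (n + m) (q + 0)" by simp
  then have "M = 0\<^sub>m (n + m) (q + 0)"
    using inv(1,3) Lc Mc by (simp add: assoc_mult_mat[OF inv(1) Lc Mc, symmetric])
  then have "four_block_mat X (0\<^sub>m n 0) Y (0\<^sub>m m 0) =
      four_block_mat (0\<^sub>m n q) (0\<^sub>m n 0) (0\<^sub>m m q) (0\<^sub>m m 0)"
    by (simp add: M_def)
  from four_block_mat_inject(1,3)[OF this, of n q 0 m] X Y
  show "X = 0\<^sub>m n q \<and> Y = 0\<^sub>m m q" by simp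
qed

section \<open>Convergence of the doubling algorithm\<close>

theorem theorem15:
  fixes m n :: nat
    and A B C D K \<Phi> \<Psi> R S :: "real mat"
    and E F G H :: "nat \<Rightarrow> real mat"
    and \<alpha> \<beta> :: real
    and \<nu> :: "real mat \<Rightarrow> real"
  assumes "m \<ge> 1" and "n \<ge> 1"
    and "A \<in> carrier_mat m m" and "B \<in> carrier_mat m n"
    and "C \<in> carrier_mat n m" and "D \<in> carrier_mat n n"
    and "K = four_block_mat D (- C) (- B) A"
    and "regular_M_matrix K" and "singular_M_matrix K"
    and "\<alpha> > Max ((\<lambda>i. A $$ (i,i)) ` {..<m})"
    and "\<beta> > Max ((\<lambda>i. D $$ (i,i)) ` {..<n})"
    and "min_nonneg_solution m n (\<lambda>X. X * C * X - X * D - A * X + B = 0\<^sub>m m n) \<Phi>"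
    and "min_nonneg_solution n m (\<lambda>Y. Y * B * Y - Y * A - D * Y + C = 0\<^sub>m n m) \<Psi>"
    and "R = D - C * \<Phi>" and "S = A - B * \<Psi>"
    and "\<And>k. adda A B C D \<alpha> \<beta> k = (E k, F k, G k, H k)"
    and "norm_on_mats m n \<nu>" and "norm_on_mats n m \<nu>"
  shows "adda_well_defined A B C D \<alpha> \<beta> \<and>
    (\<forall>k. nonsingular_M_matrix (1\<^sub>m n - G k * H k) \<and>
         nonsingular_M_matrix (1\<^sub>m m - H k * G k)) \<and>
    E 0 \<le> 0\<^sub>m n n \<and> F 0 \<le> 0\<^sub>m m m \<and>
    (\<forall>k\<ge>1. 0\<^sub>m n n \<le> E k \<and> 0\<^sub>m m m \<le> F k \<and>
         0\<^sub>m m n \<le> H (k - 1) \<and> H (k - 1) \<le> H k \<and> H k \<le> \<Phi> \<and>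
         0\<^sub>m n m \<le> G (k - 1) \<and> G (k - 1) \<le> G k \<and> G k \<le> \<Psi>) \<and>
    invertible_mat (R + \<alpha> \<cdot>\<^sub>m 1\<^sub>m n) \<and> invertible_mat (S + \<beta> \<cdot>\<^sub>m 1\<^sub>m m) \<and>
    limsup (\<lambda>k. ereal (root (2 ^ k) (\<nu> (H k - \<Phi>)))) \<le> ereal (adda_rate m n R S \<alpha> \<beta>) \<and>
    limsup (\<lambda>k. ereal (root (2 ^ k) (\<nu> (G k - \<Psi>)))) \<le> ereal (adda_rate m n R S \<alpha> \<beta>)"
proof (rule regular_block_M_matrix[OF assms(3-6) assms(8)[unfolded assms(7)]])
  fix v1 v2
  assume nonneg: "0\<^sub>m m n \<le> B" "0\<^sub>m n m \<le> C"
    and ZA: "\<And>i j. i < m \<Longrightarrow> j < m \<Longrightarrow> i \<noteq> j \<Longrightarrow> A $$ (i,j) \<le> 0"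
    and ZD: "\<And>i j. i < n \<Longrightarrow> j < n \<Longrightarrow> i \<noteq> j \<Longrightarrow> D $$ (i,j) \<le> 0"
    and v1: "v1 \<in> carrier_vec n" "\<And>j. j < n \<Longrightarrow> 0 < v1 $ j"
    and v2: "v2 \<in> carrier_vec m" "\<And>i. i < m \<Longrightarrow> 0 < v2 $ i"
    and super: "C *\<^sub>v v2 \<le> D *\<^sub>v v1" "B *\<^sub>v v1 \<le> A *\<^sub>v v2"
  have mn: "0 < m" "0 < n" using assms(1,2) by auto
  note car = assms(3-6)
  have v0: "0\<^sub>v n \<le> v1" "0\<^sub>v m \<le> v2" using v1 v2 by (auto simp: less_eq_vec_def less_imp_le)
  have \<alpha>A: "A $$ (i,i) < \<alpha>" if "i < m" for i
    by (rule le_less_trans[OF Max_ge assms(10)]) (use that in auto)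
  have \<beta>D: "D $$ (i,i) < \<beta>" if "i < n" for i
    by (rule le_less_trans[OF Max_ge assms(11)]) (use that in auto)
  have "0\<^sub>v m \<le> A *\<^sub>v v2"
    using mult_mat_nonneg_vec[OF car(2) nonneg(1) v1(1) v0(1)] super(2) by (rule order_trans)
  then have "0 \<le> A $$ (0,0)"
    by (intro Z_mat_diag_nonneg[OF car(1) ZA v2 mn(1)] nonneg_vecD[OF _ mn(1)])
  \<comment> \<open>A positive vector with nonnegative image forces a nonnegative diagonal, so \<open>\<alpha>\<close> is positive.\<close>
  then have \<alpha>: "0 < \<alpha>" using \<alpha>A[OF mn(1)] by simp
  have "0\<^sub>v n \<le> D *\<^sub>v v1"
    using mult_mat_nonneg_vec[OF car(3) nonneg(2) v2(1) v0(2)] super(1) by (rule order_trans)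
  then have "0 \<le> D $$ (0,0)"
    by (intro Z_mat_diag_nonneg[OF car(4) ZD v1 mn(2)] nonneg_vecD[OF _ mn(2)])
  then have \<beta>: "0 < \<beta>" using \<beta>D[OF mn(2)] by simp
  have \<Phi>: "\<Phi> \<in> carrier_mat m n" "0\<^sub>m m n \<le> \<Phi>"
    and ric\<Phi>: "\<Phi> * C * \<Phi> - \<Phi> * D - A * \<Phi> + B = 0\<^sub>m m n"
    using assms(12) by (auto simp: min_nonneg_solution_def)
  have \<Psi>: "\<Psi> \<in> carrier_mat n m" "0\<^sub>m n m \<le> \<Psi>"
    and ric\<Psi>: "\<Psi> * B * \<Psi> - \<Psi> * A - D * \<Psi> + C = 0\<^sub>m n m"
    using assms(13) by (auto simp: min_nonneg_solution_def)
  have A': "0\<^sub>m m m \<le> \<alpha> \<cdot>\<^sub>m 1\<^sub>m m - A"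
  proof (rule mat_leI[of _ m m])
    fix i j assume ij: "i < m" "j < m"
    then show "0\<^sub>m m m $$ (i,j) \<le> (\<alpha> \<cdot>\<^sub>m 1\<^sub>m m - A) $$ (i,j)"
      using ZA[OF ij] \<alpha>A[OF ij(1)] car by (cases "i = j") auto
  qed (use car in \<open>auto simp: minus_carrier_mat\<close>)
  have D': "0\<^sub>m n n \<le> \<beta> \<cdot>\<^sub>m 1\<^sub>m n - D"
  proof (rule mat_leI[of _ n n])
    fix i j assume ij: "i < n" "j < n"
    then show "0\<^sub>m n n $$ (i,j) \<le> (\<beta> \<cdot>\<^sub>m 1\<^sub>m n - D) $$ (i,j)"
      using ZD[OF ij] \<beta>D[OF ij(1)] car by (cases "i = j") auto
  qed (use car in \<open>auto simp: minus_carrier_mat\<close>)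
  have \<Phi>v: "\<Phi> *\<^sub>v v1 \<le> v2"
    by (rule min_solution_le_positive_vec[OF car nonneg A' D' less_imp_le[OF \<beta>]
        add_pos_pos[OF \<alpha> \<beta>] v1 v2 super assms(12)])
  have \<Psi>v: "\<Psi> *\<^sub>v v2 \<le> v1"
    by (rule min_solution_le_positive_vec[OF car(4,3,2,1) nonneg(2,1) D' A' less_imp_le[OF \<alpha>]
        add_pos_pos[OF \<beta> \<alpha>] v2 v1 super(2,1) assms(13)])
  define T where "T = mat_inv (R + \<alpha> \<cdot>\<^sub>m 1\<^sub>m n) * (R - \<beta> \<cdot>\<^sub>m 1\<^sub>m n)"
  define U where "U = mat_inv (S + \<beta> \<cdot>\<^sub>m 1\<^sub>m m) * (S - \<alpha> \<cdot>\<^sub>m 1\<^sub>m m)"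
  note shiftR = closed_loop_shift[OF car(3,4) ZD \<beta>D \<alpha> nonneg(2) \<Phi> v1 v2(1) \<Phi>v super(1) assms(14)]
  note shiftS = closed_loop_shift[OF car(2,1) ZA \<alpha>A \<beta> nonneg(1) \<Psi> v2 v1(1) \<Psi>v super(2) assms(15)]
  have T: "nonneg_posdiag n (- T)" "((D - C * \<Phi>) + \<alpha> \<cdot>\<^sub>m 1\<^sub>m n) * T = (D - C * \<Phi>) - \<beta> \<cdot>\<^sub>m 1\<^sub>m n"
    and invR: "invertible_mat (R + \<alpha> \<cdot>\<^sub>m 1\<^sub>m n)"
    using shiftR by (simp_all add: T_def assms(14)[symmetric])
  have U: "nonneg_posdiag m (- U)" "((A - B * \<Psi>) + \<beta> \<cdot>\<^sub>m 1\<^sub>m m) * U = (A - B * \<Psi>) - \<alpha> \<cdot>\<^sub>m 1\<^sub>m m"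
    and invS: "invertible_mat (S + \<beta> \<cdot>\<^sub>m 1\<^sub>m m)"
    using shiftS by (simp_all add: U_def assms(15)[symmetric])
  have Tc: "T \<in> carrier_mat n n" and Uc: "U \<in> carrier_mat m m"
    using nonneg_posdiag_carrier[OF T(1)] nonneg_posdiag_carrier[OF U(1)] by simp_all
  have init: "adda_init A B C D \<alpha> \<beta> = (E 0, F 0, G 0, H 0)" using assms(16)[of 0] by simp
  note ini = adda_init_properties[OF car nonneg ZA ZD \<alpha> \<alpha>A \<beta> \<beta>D v1 v2 super init]
  have E0: "nonneg_posdiag n (- E 0)" and F0: "nonneg_posdiag m (- F 0)"
    and G0: "G 0 \<in> carrier_mat n m" "0\<^sub>m n m \<le> G 0" and H0: "H 0 \<in> carrier_mat m n" "0\<^sub>m m n \<le> H 0"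
    and lhs: "invertible_mat (adda_lhs A B C D \<alpha> \<beta>)"
    by (rule ini; assumption)+
  have Ec: "E 0 \<in> carrier_mat n n" and Fc: "F 0 \<in> carrier_mat m m"
    using nonneg_posdiag_carrier[OF E0] nonneg_posdiag_carrier[OF F0] by simp_all
  have b1: "(D + \<alpha> \<cdot>\<^sub>m 1\<^sub>m n) * E 0 + C * H 0 = D - \<beta> \<cdot>\<^sub>m 1\<^sub>m n"
    and b2: "(D + \<alpha> \<cdot>\<^sub>m 1\<^sub>m n) * G 0 + C * F 0 = C"
    and b3: "B * E 0 + (A + \<beta> \<cdot>\<^sub>m 1\<^sub>m m) * H 0 = B"
    and b4: "B * G 0 + (A + \<beta> \<cdot>\<^sub>m 1\<^sub>m m) * F 0 = A - \<alpha> \<cdot>\<^sub>m 1\<^sub>m m"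
    by (rule ini; assumption)+
  have inj: "X = 0\<^sub>m n q \<and> Y = 0\<^sub>m m q" if "X \<in> carrier_mat n q" "Y \<in> carrier_mat m q"
      "(D + \<alpha> \<cdot>\<^sub>m 1\<^sub>m n) * X = C * Y" "(A + \<beta> \<cdot>\<^sub>m 1\<^sub>m m) * Y = B * X" for X Y q
    by (rule ini(12); (rule that)?; assumption?)
  have D\<alpha>: "D + \<alpha> \<cdot>\<^sub>m 1\<^sub>m n \<in> carrier_mat n n" and A\<beta>: "A + \<beta> \<cdot>\<^sub>m 1\<^sub>m m \<in> carrier_mat m m"
    by simp_all
  \<comment> \<open>The same four equations in the form that the exchange of the two dimensions requires.\<close>
  have c1: "(A + \<beta> \<cdot>\<^sub>m 1\<^sub>m m) * F 0 + B * G 0 = A - \<alpha> \<cdot>\<^sub>m 1\<^sub>m m"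
    using b4 comm_add_mat[OF mult_carrier_mat[OF car(2) G0(1)] mult_carrier_mat[OF A\<beta> Fc]] by simp
  have c2: "(A + \<beta> \<cdot>\<^sub>m 1\<^sub>m m) * H 0 + B * E 0 = B"
    using b3 comm_add_mat[OF mult_carrier_mat[OF car(2) Ec] mult_carrier_mat[OF A\<beta> H0(1)]] by simp
  have c3: "C * F 0 + (D + \<alpha> \<cdot>\<^sub>m 1\<^sub>m n) * G 0 = C"
    using b2 comm_add_mat[OF mult_carrier_mat[OF car(3) Fc] mult_carrier_mat[OF D\<alpha> G0(1)]] by simp
  have c4: "C * H 0 + (D + \<alpha> \<cdot>\<^sub>m 1\<^sub>m n) * E 0 = D - \<beta> \<cdot>\<^sub>m 1\<^sub>m n"
    using b1 comm_add_mat[OF mult_carrier_mat[OF car(3) H0(1)] mult_carrier_mat[OF D\<alpha> Ec]] by simp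
  have inj': "X = 0\<^sub>m m m \<and> Y = 0\<^sub>m n m" if "X \<in> carrier_mat m m" "Y \<in> carrier_mat n m"
      "(A + \<beta> \<cdot>\<^sub>m 1\<^sub>m m) * X = B * Y" "(D + \<alpha> \<cdot>\<^sub>m 1\<^sub>m n) * Y = C * X" for X Y
    using inj[OF that(2,1,4,3)] by simp
  note idE = doubling_initial_identities[OF car Ec Fc G0(1) H0(1) \<Phi>(1) Tc b1 b2 b3 b4 inj ric\<Phi> T(2)]
  note idF = doubling_initial_identities[OF car(4,3,2,1) Fc Ec H0(1) G0(1) \<Psi>(1) Uc c1 c2 c3 c4 inj' ric\<Psi> U(2)]
  have idE1: "E 0 = (1\<^sub>m n - G 0 * \<Phi>) * T" and idE2: "\<Phi> - H 0 = F 0 * \<Phi> * T"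
    by (rule idE; assumption)+
  have idF1: "F 0 = (1\<^sub>m m - H 0 * \<Psi>) * U" and idF2: "\<Psi> - G 0 = E 0 * \<Psi> * U"
    by (rule idF; assumption)+
  \<comment> \<open>At \<open>k = 0\<close> all four matrices change sign; one doubling step removes the signs.\<close>
  define Tk where "Tk k = (if k = 0 then - T else T ^\<^sub>m (2 ^ k))" for k :: nat
  define Uk where "Uk k = (if k = 0 then - U else U ^\<^sub>m (2 ^ k))" for k :: nat
  define Ek where "Ek k = (if k = 0 then - E k else E k)" for k
  define Fk where "Fk k = (if k = 0 then - F k else F k)" for k
  have Tk_Suc: "Tk k * Tk k = Tk (Suc k)" for k
    using pow_mat_double[OF Tc, of "2 ^ k"] Tc
    by (cases "k = 0") (auto simp: Tk_def uminus_mult_uminus_mat)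
  have Uk_Suc: "Uk k * Uk k = Uk (Suc k)" for k
    using pow_mat_double[OF Uc, of "2 ^ k"] Uc
    by (cases "k = 0") (auto simp: Uk_def uminus_mult_uminus_mat)
  note inverse1 = doubling_state_inverse[OF _ mn(2) \<Phi> \<Psi> v1 v2 \<Phi>v \<Psi>v]
  note inverse2 = doubling_state_inverse[OF doubling_state_swap mn(1) \<Psi> \<Phi> v2 v1 \<Psi>v \<Phi>v]
  have step: "doubling_state n m \<Phi> \<Psi> (Tk (Suc k)) (Uk (Suc k)) (Ek (Suc k)) (Fk (Suc k)) (G (Suc k)) (H (Suc k))
      \<and> G k \<le> G (Suc k) \<and> H k \<le> H (Suc k)"
    if st: "doubling_state n m \<Phi> \<Psi> (Tk k) (Uk k) (Ek k) (Fk k) (G k) (H k)" for k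
  proof -
    define V where "V = mat_inv (1\<^sub>m n - G k * H k)"
    define W where "W = mat_inv (1\<^sub>m m - H k * G k)"
    have V: "nonneg_posdiag n V" "V * (1\<^sub>m n - G k * H k) = 1\<^sub>m n"
      unfolding V_def using inverse1(3,4)[OF st] by simp_all
    have W: "nonneg_posdiag m W" "W * (1\<^sub>m m - H k * G k) = 1\<^sub>m m"
      unfolding W_def using inverse2(3,4)[OF st] by simp_all
    have Gk: "G k \<in> carrier_mat n m" and Hk: "H k \<in> carrier_mat m n"
      and Ekc: "Ek k \<in> carrier_mat n n" and Fkc: "Fk k \<in> carrier_mat m m"
      using st unfolding doubling_state_def nonneg_posdiag_def by blast+
    then have c: "E k \<in> carrier_mat n n" "F k \<in> carrier_mat m m"
      by (auto simp: Ek_def Fk_def split: if_splits)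
    have Vc: "V \<in> carrier_mat n n" and Wc: "W \<in> carrier_mat m m"
      using V W by (simp_all add: nonneg_posdiag_def)
    have "(E (Suc k), F (Suc k), G (Suc k), H (Suc k)) = adda_step (E k, F k, G k, H k)"
      using assms(16)[of "Suc k"] assms(16)[of k] by simp
    then have "E (Suc k) = E k * V * E k" "F (Suc k) = F k * W * F k"
        "G (Suc k) = G k + E k * V * G k * F k" "H (Suc k) = H k + F k * W * H k * E k"
      using Gk Hk by (simp_all add: V_def W_def Let_def)
    moreover have "E k * V * E k = Ek k * V * Ek k" "F k * W * F k = Fk k * W * Fk k"
        "E k * V * G k * F k = Ek k * V * G k * Fk k" "F k * W * H k * E k = Fk k * W * H k * Ek k"
      using c Vc Wc Gk Hk
      by (cases "k = 0"; simp add: Ek_def Fk_def uminus_mult_uminus_mat del: assoc_mult_mat)+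
    ultimately have eqs: "Ek (Suc k) = Ek k * V * Ek k" "Fk (Suc k) = Fk k * W * Fk k"
        "G (Suc k) = G k + Ek k * V * G k * Fk k" "H (Suc k) = H k + Fk k * W * H k * Ek k"
      by (simp_all add: Ek_def[of "Suc k"] Fk_def[of "Suc k"])
    show ?thesis
      using doubling_state_step[OF st \<Phi>(1) \<Psi>(1) V W] unfolding Tk_Suc Uk_Suc eqs[symmetric] by blast
  qed
  have st: "doubling_state n m \<Phi> \<Psi> (Tk k) (Uk k) (Ek k) (Fk k) (G k) (H k)" for k
  proof (induction k)
    case 0
    have "- E 0 = (1\<^sub>m n - G 0 * \<Phi>) * - T" "- F 0 = (1\<^sub>m m - H 0 * \<Psi>) * - U"
      using idE1 idF1 G0 H0 \<Phi> \<Psi> Tc Uc by (simp_all add: uminus_mult_uminus_mat)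
    moreover have "\<Phi> - H 0 = - F 0 * \<Phi> * - T" "\<Psi> - G 0 = - E 0 * \<Psi> * - U"
      using idE2 idF2 Ec Fc \<Phi> \<Psi> Tc Uc by (simp_all add: uminus_mult_uminus_mat)
    ultimately show ?case
      unfolding doubling_state_def Tk_def Uk_def Ek_def Fk_def
      using E0 F0 G0 H0 T(1) U(1) by simp
  next
    case (Suc k)
    then show ?case using step by blast
  qed
  have GHc: "G k \<in> carrier_mat n m" "H k \<in> carrier_mat m n" "0\<^sub>m n m \<le> G k" "0\<^sub>m m n \<le> H k" for k
    using st[of k] unfolding doubling_state_def by blast+
  have M1: "nonsingular_M_matrix (1\<^sub>m n - G k * H k)" "invertible_mat (1\<^sub>m n - G k * H k)"
    and M2: "nonsingular_M_matrix (1\<^sub>m m - H k * G k)" "invertible_mat (1\<^sub>m m - H k * G k)" for k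
    using inverse1(1,2)[OF st] inverse2(1,2)[OF st] by simp_all
  have le: "H k \<le> \<Phi>" "G k \<le> \<Psi>" for k
    using doubling_state_H_le[OF st \<Phi>] doubling_state_H_le[OF doubling_state_swap[OF st] \<Psi>] by simp_all
  have wd: "adda_well_defined A B C D \<alpha> \<beta>"
    unfolding adda_well_defined_def using lhs M1(2) M2(2) GHc
    by (simp add: assms(16) carrier_matD(1)[OF GHc(1)] carrier_matD(1)[OF GHc(2)])
  have neg: "E 0 \<le> 0\<^sub>m n n" "F 0 \<le> 0\<^sub>m m m"
    using nonneg_matD[OF nonneg_posdiag_nonneg[OF E0]] nonneg_matD[OF nonneg_posdiag_nonneg[OF F0]] Ec Fc
    by (auto intro!: mat_leI[OF Ec] mat_leI[OF Fc])
  have EF: "0\<^sub>m n n \<le> E k" "0\<^sub>m m m \<le> F k" if "1 \<le> k" for k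
    using st[of k] that unfolding doubling_state_def nonneg_posdiag_def Ek_def Fk_def by auto
  have mono: "H (k - 1) \<le> H k" "G (k - 1) \<le> G k" if "1 \<le> k" for k
    using step[OF st, of "k - 1"] that by auto
  have errH: "\<bar>(H k - \<Phi>) $$ (i,j)\<bar> \<le> (U ^\<^sub>m (2 ^ k) * \<Phi> * T ^\<^sub>m (2 ^ k)) $$ (i,j)"
    if "1 \<le> k" "i < m" "j < n" for k i j
  proof -
    have "\<Phi> - H k \<le> Uk k * \<Phi> * Tk k" by (rule doubling_state_error_le[OF st \<Phi> \<Psi>])
    from mat_leD[OF this minus_carrier_mat[OF GHc(2)] that(2,3)] mat_leD[OF le(1) GHc(2) that(2,3)] that
    show ?thesis using \<Phi>(1) GHc(2)[of k] by (simp add: Uk_def Tk_def del: index_mult_mat(1) assoc_mult_mat)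
  qed
  have errG: "\<bar>(G k - \<Psi>) $$ (i,j)\<bar> \<le> (T ^\<^sub>m (2 ^ k) * \<Psi> * U ^\<^sub>m (2 ^ k)) $$ (i,j)"
    if "1 \<le> k" "i < n" "j < m" for k i j
  proof -
    have "\<Psi> - G k \<le> Tk k * \<Psi> * Uk k"
      by (rule doubling_state_error_le[OF doubling_state_swap[OF st] \<Psi> \<Phi>])
    from mat_leD[OF this minus_carrier_mat[OF GHc(1)] that(2,3)] mat_leD[OF le(2) GHc(1) that(2,3)] that
    show ?thesis using \<Psi>(1) GHc(1)[of k] by (simp add: Uk_def Tk_def del: index_mult_mat(1) assoc_mult_mat)
  qed
  have rate: "adda_rate m n R S \<alpha> \<beta> = rho T * rho U"
    by (simp add: adda_rate_def T_def U_def)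
  have "limsup (\<lambda>k. ereal (root (2 ^ k) (\<nu> (H k - \<Phi>)))) \<le> ereal (rho U * rho T)"
    by (rule limsup_root_norm_le_rho_mult_rho[OF Uc Tc \<Phi>(1) mn assms(17) minus_carrier_mat[OF \<Phi>(1)] errH])
  moreover have "limsup (\<lambda>k. ereal (root (2 ^ k) (\<nu> (G k - \<Psi>)))) \<le> ereal (rho T * rho U)"
    by (rule limsup_root_norm_le_rho_mult_rho[OF Tc Uc \<Psi>(1) mn(2,1) assms(18) minus_carrier_mat[OF \<Psi>(1)] errG])
  ultimately show ?thesis
    using wd M1(1) M2(1) neg EF mono le GHc(3,4) invR invS by (simp add: rate mult.commute)
qed

end
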